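(* Let $\mathbf{S}=\Gamma\cup\{\gamma(t):t\in\mathbb{R}\}$ with the continuous flow $(\varphi_t)_{t\in\mathbb{R}}$ described in the context, and let $T_0(1)$ be the contraction on $C_0(\mathbf{S}\setminus\{1\})$ given by $(T_0(1)f)(x)=f(\varphi_1(x))$. Then $T_0(1)$ has no unimodular eigenvalues and is almost weakly stable. On the other hand, $\omega(2n^2-4n+3)=-(2n-1)\pi$ for every positive integer $n$, hence $\lim_{n\to\infty}\gamma(2n^2-4n+3)=-1$, and for every $f\in C_0(\mathbf{S}\setminus\{1\})$ $$\lim_{n\to\infty}\langle T_0(1)^{2n^2-4n+3}f,\delta_{\gamma(0)}\rangle=\lim_{n\to\infty}f(\gamma(2n^2-4n+3))=f(-1),$$ where $\delta_{\gamma(0)}$ is the point evaluation at $\gamma(0)$. So the powers of $T_0(1)$ do not converge weakly to zero along the polynomial $p(X)=2X^2-4X+3$. Consequently $T_0(1)$ is almost weakly stable, but not almost weakly polynomial stable.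
   Context: $\mathbb{N}^+$ denotes the positive integers and $\Gamma\subset\mathbb{C}$ the unit circle. The flow on $\Gamma$: the point $1$ is fixed, and $\Gamma\setminus\{1\}$ is the (homoclinic) orbit of $-1$, with $\varphi_t(-1)=e^{\frac{\pi}{t+1}i}$ for $t\ge 0$ and $\varphi_t(-1)=e^{\frac{\pi}{t-1}i}$ for $t\le 0$ (so $\varphi_t(\varphi_s(-1))=\varphi_{s+t}(-1)$). The curve $\gamma:\mathbb{R}\to\mathbb{C}$ in the open unit disk is $\gamma(t)=r(t)e^{\omega(t)i}$, where $r(t)=1-\frac{1}{2t}$ for $t\ge 1$, $r(t)=\frac{e^{t-1}}{2}$ for $t\le 1$, and - $\omega(t)=-t\pi$ for $t\le 3$; - $\omega(t)=-4\pi+\frac{\pi}{t-2}$ for $3\le t\le 4$; - for every integer $k\ge 2$: $\omega(t)=-2k\pi+\frac{2k^2-2k+2-t}{k^2}\pi$ for $2k^2-3k+2\le t\le 2k^2-k+2$; $\omega(t)=-2k\pi-\frac{\pi}{2k^2+2-t}$ for $2k^2-k+2\le t\le 2k^2+1$; and $\omega(t)=-(2k+2)\pi+\frac{\pi}{t-2k^2}$ for $2k^2+1\le t\le 2k^2+k+1$. The flow on the curve is $\varphi_t(\gamma(s))=\gamma(s+t)$ for $s,t\in\mathbb{R}$. Together these define a continuous flow on $\mathbf{S}=\Gamma\cup\{\gamma(t):t\in\mathbb{R}\}$. $C_0(\mathbf{S}\setminus\{1\})$ is the Banach space (supremum norm) of continuous functions on $\mathbf{S}\setminus\{1\}$ vanishing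 at infinity; its elements are regarded as functions on $\mathbf{S}$ with $f(1)=0$. On it, $(T_0(t)f)(x)=f(\varphi_t(x))$ for $t\ge 0$. The density of a strictly increasing sequence $\{n_k\}\subset\mathbb{N}^+$ is $\lim_{n\to\infty}\frac1n|\{k: n_k\le n\}|$, if this limit exists. A sequence $\{x_n\}_{n\in\mathbb{N}^+}$ in a Banach space $X$ is almost weakly stable if there is a sequence $\{n_k\}$ of density $1$ with $x_{n_k}\to 0$ weakly. A bounded operator $T$ on $X$ is almost weakly stable if $\{T^nx\}_{n\in\mathbb{N}^+}$ is almost weakly stable for every $x\in X$; it is almost weakly polynomial stable if $\{T^{p(n)}x\}_{n\in\mathbb{N}^+}$ is almost weakly stable for every $x\in X$ and every non-constant polynomial $p$ with integer coefficients mapping $\mathbb{N}^+$ into the nonnegative integers. *)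

theory Defs
  imports "HOL-Analysis.Analysis" "HOL-Computational_Algebra.Polynomial"
begin

section \<open>Complex Banach spaces and weak stability\<close>

class complex_banach = banach +
  fixes scaleC :: "complex \<Rightarrow> 'a \<Rightarrow> 'a" (infixr \<open>*\<^sub>C\<close> 75)
  assumes scaleC_add_right: "c *\<^sub>C (x + y) = c *\<^sub>C x + c *\<^sub>C y"
    and scaleC_add_left: "(c + d) *\<^sub>C x = c *\<^sub>C x + d *\<^sub>C x"
    and scaleC_scaleC: "c *\<^sub>C (d *\<^sub>C x) = (c * d) *\<^sub>C x"
    and scaleR_scaleC: "r *\<^sub>R x = complex_of_real r *\<^sub>C x"
    and norm_scaleC: "norm (c *\<^sub>C x) = cmod c * norm x"

instantiation complex :: complex_banach
begin

definition scaleC_complex :: "complex \<Rightarrow> complex \<Rightarrow> complex" where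
  "scaleC_complex c x = c * x"

instance
  by standard (simp_all add: scaleC_complex_def algebra_simps scaleR_conv_of_real norm_mult)

end

definition bounded_clinear :: "('a::complex_banach \<Rightarrow> 'b::complex_banach) \<Rightarrow> bool" where
  "bounded_clinear T \<longleftrightarrow> bounded_linear T \<and> (\<forall>c x. T (c *\<^sub>C x) = c *\<^sub>C T x)"

definition eigenvalue :: "('a::complex_banach \<Rightarrow> 'a) \<Rightarrow> complex \<Rightarrow> bool" where
  "eigenvalue T z \<longleftrightarrow> (\<exists>x. x \<noteq> 0 \<and> T x = z *\<^sub>C x)"

definition weakly_tendsto :: "(nat \<Rightarrow> 'a::complex_banach) \<Rightarrow> 'a \<Rightarrow> bool" where
  "weakly_tendsto x l \<longleftrightarrow>
     (\<forall>L :: 'a \<Rightarrow> complex. bounded_clinear L \<longrightarrow> (\<lambda>n. L (x n)) \<longlonglongrightarrow> L l)"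

definition has_density :: "(nat \<Rightarrow> nat) \<Rightarrow> real \<Rightarrow> bool" where
  "has_density \<nu> d \<longleftrightarrow> (\<lambda>n. real (card {k. \<nu> k \<le> n}) / real n) \<longlonglongrightarrow> d"

text \<open>A sequence indexed by the positive integers is a function on \<^typ>\<open>nat\<close> whose value
  at \<open>0\<close> is never looked at. The terms of the index sequence \<open>\<nu>\<close> are numbered from \<open>0\<close>.\<close>

definition almost_weakly_stable_seq :: "(nat \<Rightarrow> 'a::complex_banach) \<Rightarrow> bool" where
  "almost_weakly_stable_seq x \<longleftrightarrow>
     (\<exists>\<nu>. strict_mono \<nu> \<and> (\<forall>k. 1 \<le> \<nu> k) \<and> has_density \<nu> 1 \<and> weakly_tendsto (\<lambda>k. x (\<nu> k)) 0)"

text \<open>The next two notions are meant for bounded complex-linear \<open>T\<close>. Boundedness is kept out of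
  the definitions so that their negations say no less than they should.\<close>

definition almost_weakly_stable :: "('a::complex_banach \<Rightarrow> 'a) \<Rightarrow> bool" where
  "almost_weakly_stable T \<longleftrightarrow> (\<forall>x. almost_weakly_stable_seq (\<lambda>n. (T ^^ n) x))"

definition almost_weakly_polynomial_stable :: "('a::complex_banach \<Rightarrow> 'a) \<Rightarrow> bool" where
  "almost_weakly_polynomial_stable T \<longleftrightarrow>
     (\<forall>x. \<forall>p :: int poly. degree p > 0 \<and> (\<forall>n::nat. 1 \<le> n \<longrightarrow> 0 \<le> poly p (int n)) \<longrightarrow>
        almost_weakly_stable_seq (\<lambda>n. (T ^^ nat (poly p (int n))) x))"


section \<open>The curve\<close>

definition radius :: "real \<Rightarrow> real" where
  "radius t = (if t \<ge> 1 then 1 - 1 / (2 * t) else exp (t - 1) / 2)"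

text \<open>For \<open>t > 4\<close>, the index of the block
  \<open>2 * k\<^sup>2 - 3 * k + 2 \<le> t \<le> 2 * k\<^sup>2 + k + 1\<close>, \<open>k \<ge> 2\<close>, containing \<open>t\<close>; consecutive blocks share
  an end point, at which the smaller index is taken.\<close>

definition block :: "real \<Rightarrow> nat" where
  "block t = (LEAST k. 2 \<le> k \<and> t \<le> 2 * real k ^ 2 + real k + 1)"

definition omega :: "real \<Rightarrow> real" where
  "omega t =
    (if t \<le> 3 then - t * pi
     else if t \<le> 4 then - 4 * pi + pi / (t - 2)
     else let k = real (block t) in
       if t \<le> 2 * k ^ 2 - k + 2
         then - 2 * k * pi + (2 * k ^ 2 - 2 * k + 2 - t) / k ^ 2 * pi
       else if t \<le> 2 * k ^ 2 + 1
         then - 2 * k * pi - pi / (2 * k ^ 2 + 2 - t)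
       else - (2 * k + 2) * pi + pi / (t - 2 * k ^ 2))"

lemma block_eqI:
  fixes k :: nat
  assumes k: "2 \<le> k" and lower: "2 * real k ^ 2 - 3 * real k + 2 < t"
    and upper: "t \<le> 2 * real k ^ 2 + real k + 1"
  shows "block t = k"
  unfolding block_def
proof (rule Least_equality)
  show "2 \<le> k \<and> t \<le> 2 * real k ^ 2 + real k + 1"
    using k upper by simp
next
  fix j :: nat
  assume j: "2 \<le> j \<and> t \<le> 2 * real j ^ 2 + real j + 1"
  show "k \<le> j"
  proof (rule ccontr)
    assume "\<not> k \<le> j"
    then have le: "real j \<le> real k - 1" by linarith
    have "real j ^ 2 \<le> (real k - 1) ^ 2"
      using le by (intro power_mono) auto
    with le have "2 * real j ^ 2 + real j + 1 \<le> 2 * (real k - 1) ^ 2 + (real k - 1) + 1"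
      by linarith
    also have "\<dots> = 2 * real k ^ 2 - 3 * real k + 2"
      by (simp add: power2_eq_square algebra_simps)
    finally show False using j lower by linarith
  qed
qed

text \<open>The defining formulas of \<^const>\<open>omega\<close>, on the full closed intervals.\<close>

lemma omega_le_3: "t \<le> 3 \<Longrightarrow> omega t = - t * pi"
  by (simp add: omega_def)

lemma omega_3_4: "3 \<le> t \<Longrightarrow> t \<le> 4 \<Longrightarrow> omega t = - 4 * pi + pi / (t - 2)"
  by (auto simp: omega_def)

lemma block_start_ge_4:
  fixes k :: nat
  assumes "2 \<le> k"
  shows "4 \<le> 2 * real k ^ 2 - 3 * real k + 2"
proof -
  have "0 \<le> (2 * real k + 1) * (real k - 2)"
    using assms by (intro mult_nonneg_nonneg) auto
  then show ?thesis by (simp add: power2_eq_square algebra_simps)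
qed

lemma omega_linear:
  fixes k :: nat
  assumes k: "2 \<le> k" and lower: "2 * real k ^ 2 - 3 * real k + 2 \<le> t"
    and upper: "t \<le> 2 * real k ^ 2 - real k + 2"
  shows "omega t = - 2 * real k * pi + (2 * real k ^ 2 - 2 * real k + 2 - t) / real k ^ 2 * pi"
proof (cases "t = 2 * real k ^ 2 - 3 * real k + 2")
  case False
  with lower have less: "2 * real k ^ 2 - 3 * real k + 2 < t" by simp
  have "block t = k"
    using k less upper by (intro block_eqI) auto
  moreover have "4 < t" using block_start_ge_4[OF k] less by linarith
  ultimately show ?thesis using upper by (simp add: omega_def Let_def)
next
  case start: True
  have rhs: "(2 * real k ^ 2 - 2 * real k + 2 - t) / real k ^ 2 = 1 / real k"
    using k by (simp add: start power2_eq_square field_simps)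
  show ?thesis
  proof (cases "k = 2")
    case True
    then have "t = 4" using start by simp
    then show ?thesis using True unfolding rhs by (simp add: omega_3_4)
  next
    case False
    define j where "j = k - 1"
    have j: "2 \<le> j" and k_eq: "real k = real j + 1"
      using k False by (auto simp: j_def)
    have t_eq: "t = 2 * real j ^ 2 + real j + 1"
      unfolding start k_eq by (simp add: power2_eq_square algebra_simps)
    have block: "block t = j"
      using j by (intro block_eqI) (auto simp: t_eq)
    have "4 < t"
      using block_start_ge_4[OF j] j unfolding t_eq by linarith
    then have "omega t = - (2 * real j + 2) * pi + pi / (t - 2 * real j ^ 2)"
      using j by (simp add: omega_def Let_def block) (simp add: t_eq)
    then show ?thesis unfolding rhs by (simp add: k_eq t_eq algebra_simps)
  qed
qed

lemma omega_approach:
  fixes k :: nat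
  assumes k: "2 \<le> k" and lower: "2 * real k ^ 2 - real k + 2 \<le> t"
    and upper: "t \<le> 2 * real k ^ 2 + 1"
  shows "omega t = - 2 * real k * pi - pi / (2 * real k ^ 2 + 2 - t)"
proof (cases "t = 2 * real k ^ 2 - real k + 2")
  case True
  have "omega t = - 2 * real k * pi + (2 * real k ^ 2 - 2 * real k + 2 - t) / real k ^ 2 * pi"
    using k True by (intro omega_linear) auto
  also have "(2 * real k ^ 2 - 2 * real k + 2 - t) / real k ^ 2 = - (1 / real k)"
    using k by (simp add: True power2_eq_square field_simps)
  finally show ?thesis by (simp add: True)
next
  case False
  with lower have less: "2 * real k ^ 2 - real k + 2 < t" by simp
  have "block t = k"
    using k less upper by (intro block_eqI) auto
  moreover have "4 < t" using block_start_ge_4[OF k] less k by linarith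
  ultimately show ?thesis using less upper by (simp add: omega_def Let_def)
qed

lemma omega_depart:
  fixes k :: nat
  assumes k: "2 \<le> k" and lower: "2 * real k ^ 2 + 1 \<le> t"
    and upper: "t \<le> 2 * real k ^ 2 + real k + 1"
  shows "omega t = - (2 * real k + 2) * pi + pi / (t - 2 * real k ^ 2)"
proof (cases "t = 2 * real k ^ 2 + 1")
  case True
  have "omega t = - 2 * real k * pi - pi / (2 * real k ^ 2 + 2 - t)"
    using k True by (intro omega_approach) auto
  then show ?thesis by (simp add: True algebra_simps)
next
  case False
  with lower have less: "2 * real k ^ 2 + 1 < t" by simp
  have "block t = k"
    using k less upper by (intro block_eqI) auto
  moreover have "4 < t" using block_start_ge_4[OF k] less k by linarith
  ultimately show ?thesis using less k by (simp add: omega_def Let_def)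
qed

definition curve :: "real \<Rightarrow> complex" where
  "curve t = complex_of_real (radius t) * cis (omega t)"

lemma radius_pos: "0 < radius t"
  by (auto simp: radius_def field_simps)

lemma radius_less_1: "radius t < 1"
proof -
  have "exp (t - 1) / 2 < 1" if "t < 1"
  proof -
    have "exp (t - 1) < 1" using that by simp
    then show ?thesis by linarith
  qed
  then show ?thesis by (cases "1 \<le> t") (simp_all add: radius_def)
qed

lemma radius_strict_mono: "s < t \<Longrightarrow> radius s < radius t"
proof -
  assume st: "s < t"
  consider "1 \<le> s" | "t < 1" | "s < 1" "1 \<le> t" using st by linarith
  then show ?thesis
  proof cases
    case 3
    have "exp (s - 1) < 1" using 3 by simp
    moreover have "1 / (2 * t) \<le> 1 / 2" using 3 by (simp add: field_simps)
    ultimately have "exp (s - 1) / 2 < 1 - 1 / (2 * t)" by linarith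
    then show ?thesis using 3 by (simp add: radius_def)
  qed (use st in \<open>auto simp: radius_def field_simps\<close>)
qed

lemma norm_curve: "cmod (curve t) = radius t"
  using radius_pos[of t] by (simp add: curve_def norm_mult)

lemma inj_curve: "inj curve"
proof (rule injI)
  fix s t assume "curve s = curve t"
  then have "radius s = radius t" by (metis norm_curve)
  then show "s = t"
    using radius_strict_mono[of s t] radius_strict_mono[of t s] by linarith
qed


section \<open>The phase space and the flow\<close>

definition phase_space :: "complex set" where
  "phase_space = sphere 0 1 \<union> range curve"

text \<open>The orbit of \<open>-1\<close> on the unit circle.\<close>

definition homoclinic :: "real \<Rightarrow> complex" where
  "homoclinic t = (if 0 \<le> t then cis (pi / (t + 1)) else cis (pi / (t - 1)))"

definition flow :: "real \<Rightarrow> complex \<Rightarrow> complex" where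
  "flow t x =
    (if x = 1 then 1
     else if cmod x = 1 then homoclinic ((THE s. homoclinic s = x) + t)
     else curve ((THE s. curve s = x) + t))"

lemma Arg_homoclinic:
  "Arg (homoclinic t) = (if 0 \<le> t then pi / (t + 1) else pi / (t - 1))"
proof -
  have "pi / (t + 1) \<le> pi" if "0 \<le> t"
    using that by (simp add: field_simps)
  moreover have "- pi < pi / (t + 1)" if "0 \<le> t"
    by (rule less_trans[of _ 0]) (use that in simp_all)
  moreover have "- pi < pi / (t - 1)" if "t < 0"
  proof -
    have "- pi = pi / (- 1)" by simp
    also have "\<dots> < pi / (t - 1)"
      using that by (intro divide_strict_left_mono) auto
    finally show ?thesis .
  qed
  moreover have "pi / (t - 1) < 0" if "t < 0"
    using that by (simp add: divide_pos_neg)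
  ultimately show ?thesis
    using pi_gt_zero by (cases "0 \<le> t") (auto simp: homoclinic_def intro!: cis_Arg_unique)
qed

lemma inj_homoclinic: "inj homoclinic"
proof (rule injI)
  fix s t assume "homoclinic s = homoclinic t"
  then have eq: "Arg (homoclinic s) = Arg (homoclinic t)" by simp
  have pos: "0 < pi / (u + 1)" if "0 \<le> u" for u
    using that by simp
  have neg: "pi / (u - 1) < 0" if "u < 0" for u
    using that by (simp add: divide_pos_neg)
  show "s = t"
    using eq pos[of s] pos[of t] neg[of s] neg[of t]
    by (cases "0 \<le> s"; cases "0 \<le> t") (auto simp: Arg_homoclinic)
qed

lemma homoclinic_0: "homoclinic 0 = -1"
  by (simp add: homoclinic_def)

lemma norm_homoclinic: "cmod (homoclinic t) = 1"
  by (simp add: homoclinic_def)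

lemma homoclinic_neq_1: "homoclinic t \<noteq> 1"
proof
  assume "homoclinic t = 1"
  then have "Arg (homoclinic t) = 0" by simp
  then show False by (auto simp: Arg_homoclinic split: if_splits)
qed

lemma range_homoclinic: "range homoclinic = sphere 0 1 - {1}"
proof
  show "range homoclinic \<subseteq> sphere 0 1 - {1}"
    by (auto simp: norm_homoclinic homoclinic_neq_1)
next
  show "sphere 0 1 - {1} \<subseteq> range homoclinic"
  proof
    fix z :: complex assume "z \<in> sphere 0 1 - {1}"
    then have norm: "cmod z = 1" and neq: "z \<noteq> 1" by auto
    define a where "a = Arg z"
    have z: "z = cis a"
      using norm by (metis a_def Arg_eq cis_conv_exp mult_1 norm_zero of_real_1 zero_neq_one)
    have a: "- pi < a" "a \<le> pi"
      unfolding a_def by (simp_all add: mpi_less_Arg Arg_le_pi)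
    have "a \<noteq> 0"
    proof
      assume "a = 0"
      with z have "z = cis 0" by simp
      with neq show False by simp
    qed
    note a = a this
    show "z \<in> range homoclinic"
    proof (cases "0 < a")
      case True
      then have "0 \<le> pi / a - 1" using a by (simp add: field_simps)
      then have "homoclinic (pi / a - 1) = z" using True by (simp add: homoclinic_def z)
      then show ?thesis by blast
    next
      case False
      then have "pi / a + 1 < 0" using a by (simp add: field_simps)
      then have "homoclinic (pi / a + 1) = z" using a by (simp add: homoclinic_def z)
      then show ?thesis by blast
    qed
  qed
qed

lemma flow_1: "flow t 1 = 1"
  by (simp add: flow_def)

lemma flow_homoclinic: "flow t (homoclinic s) = homoclinic (s + t)"
proof -
  have "(THE u. homoclinic u = homoclinic s) = s"
    using inj_homoclinic by (auto simp: inj_eq)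
  then show ?thesis by (simp add: flow_def norm_homoclinic homoclinic_neq_1)
qed

lemma flow_curve: "flow t (curve s) = curve (s + t)"
proof -
  have "(THE u. curve u = curve s) = s"
    using inj_curve by (auto simp: inj_eq)
  moreover have "cmod (curve s) \<noteq> 1" using radius_less_1[of s] by (simp add: norm_curve)
  moreover from this have "curve s \<noteq> 1" by auto
  ultimately show ?thesis by (simp add: flow_def)
qed

definition continuous_flow_on :: "'a::topological_space set \<Rightarrow> (real \<Rightarrow> 'a \<Rightarrow> 'a) \<Rightarrow> bool" where
  "continuous_flow_on S \<phi> \<longleftrightarrow>
     (\<forall>t. \<phi> t ` S \<subseteq> S) \<and> (\<forall>x\<in>S. \<phi> 0 x = x) \<and>
     (\<forall>s t. \<forall>x\<in>S. \<phi> t (\<phi> s x) = \<phi> (s + t) x) \<and>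
     continuous_on (UNIV \<times> S) (\<lambda>(t, x). \<phi> t x)"


section \<open>The function space and the operators\<close>

text \<open>The space of continuous functions on \<open>phase_space - {1}\<close> vanishing at infinity. A
  function is extended by \<open>0\<close> to the whole plane, so in particular \<open>f 1 = 0\<close>. As \<open>0\<close> is a
  limit of the curve that is not in the phase space, vanishing at infinity includes decay
  along the curve at \<open>0\<close>.\<close>

definition vanishes_at_infinity_on :: "'a::topological_space set \<Rightarrow> ('a \<Rightarrow> complex) \<Rightarrow> bool" where
  "vanishes_at_infinity_on X f \<longleftrightarrow>
     (\<forall>e>0. \<exists>K. compact K \<and> K \<subseteq> X \<and> (\<forall>x\<in>X - K. cmod (f x) < e))"

typedef C0 = "{f :: complex \<Rightarrow> complex. continuous_on (phase_space - {1}) f \<and>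
    vanishes_at_infinity_on (phase_space - {1}) f \<and> (\<forall>x. x \<notin> phase_space - {1} \<longrightarrow> f x = 0)}"
  morphisms C0_apply Abs_C0
proof
  show "(\<lambda>_. 0) \<in> {f :: complex \<Rightarrow> complex. continuous_on (phase_space - {1}) f \<and>
    vanishes_at_infinity_on (phase_space - {1}) f \<and> (\<forall>x. x \<notin> phase_space - {1} \<longrightarrow> f x = 0)}"
    by (auto simp: vanishes_at_infinity_on_def)
qed

setup_lifting type_definition_C0

lemma C0_eqI: "(\<And>x. C0_apply f x = C0_apply g x) \<Longrightarrow> f = g"
  by (metis C0_apply_inject ext)

lemma vanishes_at_infinity_on_add:
  fixes f g :: "'a::t2_space \<Rightarrow> complex"
  assumes "vanishes_at_infinity_on X f" and "vanishes_at_infinity_on X g"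
  shows "vanishes_at_infinity_on X (\<lambda>x. f x + g x)"
  unfolding vanishes_at_infinity_on_def
proof (intro allI impI)
  fix e :: real assume "0 < e"
  then have "0 < e / 2" by simp
  then obtain K L where K: "compact K" "K \<subseteq> X" "\<And>x. x \<in> X - K \<Longrightarrow> cmod (f x) < e / 2"
    and L: "compact L" "L \<subseteq> X" "\<And>x. x \<in> X - L \<Longrightarrow> cmod (g x) < e / 2"
    using assms unfolding vanishes_at_infinity_on_def by metis
  have "cmod (f x + g x) < e" if "x \<in> X - (K \<union> L)" for x
    using K(3)[of x] L(3)[of x] that by (intro norm_triangle_lt) auto
  moreover have "compact (K \<union> L)" "K \<union> L \<subseteq> X"
    using K L by (auto intro: compact_Un)
  ultimately show "\<exists>K. compact K \<and> K \<subseteq> X \<and> (\<forall>x\<in>X - K. cmod (f x + g x) < e)" by blast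
qed

lemma vanishes_at_infinity_on_scale:
  assumes "vanishes_at_infinity_on X f"
  shows "vanishes_at_infinity_on X (\<lambda>x. c * f x)"
  unfolding vanishes_at_infinity_on_def
proof (intro allI impI)
  fix e :: real assume "0 < e"
  then have "0 < e / (cmod c + 1)" by (simp add: add_nonneg_pos)
  then obtain K where K: "compact K" "K \<subseteq> X" "\<forall>x\<in>X - K. cmod (f x) < e / (cmod c + 1)"
    using assms unfolding vanishes_at_infinity_on_def by meson
  have "cmod (c * f x) < e" if "x \<in> X - K" for x
  proof -
    have "cmod (f x) * (cmod c + 1) < e"
      using K that by (simp add: pos_less_divide_eq add_nonneg_pos)
    moreover have "cmod (c * f x) \<le> cmod (f x) * (cmod c + 1)"
      by (simp add: norm_mult algebra_simps)
    ultimately show ?thesis by linarith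
  qed
  with K show "\<exists>K. compact K \<and> K \<subseteq> X \<and> (\<forall>x\<in>X - K. cmod (c * f x) < e)" by blast
qed

instantiation C0 :: real_vector
begin

lift_definition zero_C0 :: C0 is "\<lambda>_. 0"
  by (auto simp: vanishes_at_infinity_on_def)

lift_definition plus_C0 :: "C0 \<Rightarrow> C0 \<Rightarrow> C0" is "\<lambda>f g x. f x + g x"
  by (simp add: vanishes_at_infinity_on_add continuous_on_add)

lift_definition uminus_C0 :: "C0 \<Rightarrow> C0" is "\<lambda>f x. - f x"
  by (simp add: vanishes_at_infinity_on_def continuous_on_minus)

definition minus_C0 :: "C0 \<Rightarrow> C0 \<Rightarrow> C0" where
  "f - g = f + - g" for f g :: C0

lift_definition scaleR_C0 :: "real \<Rightarrow> C0 \<Rightarrow> C0" is "\<lambda>r f x. complex_of_real r * f x"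
  by (simp add: vanishes_at_infinity_on_scale continuous_on_mult)

lemma C0_apply_zero [simp]: "C0_apply 0 x = 0"
  by transfer simp

lemma C0_apply_add [simp]: "C0_apply (f + g) x = C0_apply f x + C0_apply g x"
  by transfer simp

lemma C0_apply_uminus [simp]: "C0_apply (- f) x = - C0_apply f x"
  by transfer simp

lemma C0_apply_diff [simp]: "C0_apply (f - g) x = C0_apply f x - C0_apply g x"
  by (simp add: minus_C0_def)

lemma C0_apply_scaleR [simp]: "C0_apply (r *\<^sub>R f) x = complex_of_real r * C0_apply f x"
  by transfer simp

instance
  by standard (auto intro!: C0_eqI simp: algebra_simps)

end

lemma C0_apply_outside: "x \<notin> phase_space - {1} \<Longrightarrow> C0_apply f x = 0"
  using C0_apply[of f] by blast

lemma C0_continuous_on: "continuous_on (phase_space - {1}) (C0_apply f)"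
  using C0_apply[of f] by blast

lemma C0_vanishes: "vanishes_at_infinity_on (phase_space - {1}) (C0_apply f)"
  using C0_apply[of f] by blast

lemma phase_space_minus_1_nonempty: "phase_space - {1} \<noteq> {}"
proof -
  have "-1 \<in> phase_space - {1}" by (simp add: phase_space_def)
  then show ?thesis by blast
qed

lemma C0_bdd_above: "bdd_above ((\<lambda>x. cmod (C0_apply f x)) ` (phase_space - {1}))"
proof -
  obtain K where K: "compact K" "K \<subseteq> phase_space - {1}"
      "\<forall>x\<in>(phase_space - {1}) - K. cmod (C0_apply f x) < 1"
    using C0_vanishes[of f] unfolding vanishes_at_infinity_on_def by (meson zero_less_one)
  have "compact (C0_apply f ` K)"
    using K C0_continuous_on by (meson compact_continuous_image continuous_on_subset)
  then obtain B where B: "\<And>x. x \<in> K \<Longrightarrow> cmod (C0_apply f x) \<le> B"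
    using compact_imp_bounded bounded_iff by (metis imageI)
  have "cmod (C0_apply f x) \<le> max B 1" if "x \<in> phase_space - {1}" for x
    using B[of x] K(3) that by (cases "x \<in> K") (auto simp: le_max_iff_disj less_imp_le)
  then show ?thesis by (rule bdd_aboveI2)
qed

instantiation C0 :: real_normed_vector
begin

definition norm_C0 :: "C0 \<Rightarrow> real" where
  "norm_C0 f = (SUP x\<in>phase_space - {1}. cmod (C0_apply f x))"

definition sgn_C0 :: "C0 \<Rightarrow> C0" where
  "sgn_C0 f = f /\<^sub>R norm f"

definition dist_C0 :: "C0 \<Rightarrow> C0 \<Rightarrow> real" where
  "dist_C0 f g = norm (f - g)"

definition uniformity_C0 :: "(C0 \<times> C0) filter" where
  "uniformity_C0 = (INF e\<in>{0 <..}. principal {(x, y). dist x y < e})"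

definition open_C0 :: "C0 set \<Rightarrow> bool" where
  "open_C0 U = (\<forall>x\<in>U. eventually (\<lambda>(x', y). x' = x \<longrightarrow> y \<in> U) uniformity)"

lemma C0_apply_le_norm: "cmod (C0_apply f x) \<le> norm f"
proof -
  have le: "cmod (C0_apply f x) \<le> norm f" if "x \<in> phase_space - {1}" for x
    unfolding norm_C0_def using that C0_bdd_above by (rule cSUP_upper)
  moreover have "0 \<le> norm f"
    using le phase_space_minus_1_nonempty by (meson all_not_in_conv norm_ge_zero order_trans)
  ultimately show ?thesis
    by (cases "x \<in> phase_space - {1}") (simp_all add: C0_apply_outside)
qed

lemma C0_norm_leI: "(\<And>x. cmod (C0_apply f x) \<le> b) \<Longrightarrow> norm f \<le> b"
  unfolding norm_C0_def using phase_space_minus_1_nonempty by (intro cSUP_least)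

instance
proof
  fix f g :: C0 and r :: real
  show "dist f g = norm (f - g)" by (rule dist_C0_def)
  show "sgn f = f /\<^sub>R norm f" by (rule sgn_C0_def)
  show "uniformity = (INF e\<in>{0 <..}. principal {(x, y::C0). dist x y < e})"
    by (rule uniformity_C0_def)
  show "open U = (\<forall>x\<in>U. eventually (\<lambda>(x', y). x' = x \<longrightarrow> y \<in> U) uniformity)" for U :: "C0 set"
    by (rule open_C0_def)
  show "norm f = 0 \<longleftrightarrow> f = 0"
  proof
    assume "norm f = 0"
    then show "f = 0" using C0_apply_le_norm[of f] by (auto intro!: C0_eqI)
  next
    assume "f = 0"
    then show "norm f = 0" using phase_space_minus_1_nonempty by (simp add: norm_C0_def)
  qed
  show "norm (f + g) \<le> norm f + norm g"
    by (rule C0_norm_leI)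
      (simp, meson C0_apply_le_norm add_mono norm_triangle_ineq order_trans)
  have scale_le: "norm (a *\<^sub>R h) \<le> \<bar>a\<bar> * norm h" for a and h :: C0
    by (rule C0_norm_leI) (simp add: norm_mult mult_left_mono C0_apply_le_norm)
  show "norm (r *\<^sub>R f) = \<bar>r\<bar> * norm f"
  proof (cases "r = 0")
    case True
    then show ?thesis
      using scale_le[of r f] C0_apply_le_norm[of "r *\<^sub>R f" 1]
      by (auto intro: order_antisym order_trans[OF norm_ge_zero])
  next
    case False
    have "norm f = norm (inverse r *\<^sub>R (r *\<^sub>R f))" using False by simp
    also have "\<dots> \<le> \<bar>inverse r\<bar> * norm (r *\<^sub>R f)" by (rule scale_le)
    finally have "\<bar>r\<bar> * norm f \<le> norm (r *\<^sub>R f)" using False by (simp add: field_simps abs_inverse)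
    then show ?thesis using scale_le[of r f] by simp
  qed
qed

end

instance C0 :: banach
proof
  fix F :: "nat \<Rightarrow> C0"
  assume Cauchy: "Cauchy F"
  have "uniformly_Cauchy_on UNIV (\<lambda>n. C0_apply (F n))"
    unfolding uniformly_Cauchy_on_def
  proof (intro allI impI)
    fix e :: real assume "0 < e"
    then obtain N where N: "\<And>m n. m \<ge> N \<Longrightarrow> n \<ge> N \<Longrightarrow> norm (F m - F n) < e"
      using Cauchy unfolding Cauchy_def dist_norm by blast
    have "dist (C0_apply (F m) x) (C0_apply (F n) x) < e" if "m \<ge> N" "n \<ge> N" for m n x
      using C0_apply_le_norm[of "F m - F n" x] N[OF that] by (simp add: dist_norm)
    then show "\<exists>M. \<forall>x\<in>UNIV. \<forall>m\<ge>M. \<forall>n\<ge>M. dist (C0_apply (F m) x) (C0_apply (F n) x) < e"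
      by blast
  qed
  then obtain f where lim: "uniform_limit UNIV (\<lambda>n. C0_apply (F n)) f sequentially"
    using uniformly_convergent_eq_Cauchy uniformly_convergent_on_def
      Cauchy_uniformly_convergent by blast
  have close: "\<exists>N. \<forall>n\<ge>N. \<forall>x. cmod (C0_apply (F n) x - f x) < e" if "0 < e" for e
    using uniform_limitD[OF lim that] by (simp add: dist_norm eventually_sequentially)
  have "continuous_on (phase_space - {1}) f"
    using C0_continuous_on uniform_limit_on_subset[OF lim]
    by (intro uniform_limit_theorem[where F = sequentially and f = "\<lambda>n. C0_apply (F n)"]) auto
  moreover have "vanishes_at_infinity_on (phase_space - {1}) f"
    unfolding vanishes_at_infinity_on_def
  proof (intro allI impI)
    fix e :: real assume "0 < e"
    then have half: "0 < e / 2" by simp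
    then obtain n where n: "\<And>x. cmod (C0_apply (F n) x - f x) < e / 2"
      using close[OF half] by blast
    obtain K where K: "compact K" "K \<subseteq> phase_space - {1}"
      "\<forall>x\<in>(phase_space - {1}) - K. cmod (C0_apply (F n) x) < e / 2"
      using C0_vanishes half unfolding vanishes_at_infinity_on_def by meson
    have "cmod (f x) < e" if "x \<in> (phase_space - {1}) - K" for x
    proof -
      have "cmod (f x) \<le> cmod (C0_apply (F n) x) + cmod (C0_apply (F n) x - f x)"
        by (metis norm_minus_commute norm_triangle_sub)
      moreover have "cmod (C0_apply (F n) x) < e / 2" using K that by blast
      ultimately show ?thesis using n[of x] by linarith
    qed
    with K show "\<exists>K. compact K \<and> K \<subseteq> phase_space - {1} \<and>
        (\<forall>x\<in>(phase_space - {1}) - K. cmod (f x) < e)" by blast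
  qed
  moreover have "f x = 0" if "x \<notin> phase_space - {1}" for x
  proof -
    have "(\<lambda>n. C0_apply (F n) x) \<longlonglongrightarrow> f x"
      using lim by (rule tendsto_uniform_limitI) simp
    then show ?thesis using that by (simp add: C0_apply_outside LIMSEQ_const_iff)
  qed
  ultimately have apply_f: "C0_apply (Abs_C0 f) = f"
    by (intro Abs_C0_inverse) auto
  have "F \<longlonglongrightarrow> Abs_C0 f"
  proof (rule LIMSEQ_I)
    fix e :: real assume "0 < e"
    then have half: "0 < e / 2" by simp
    obtain N where N: "\<And>n x. n \<ge> N \<Longrightarrow> cmod (C0_apply (F n) x - f x) < e / 2"
      using close[OF half] by blast
    have "norm (F n - Abs_C0 f) \<le> e / 2" if "n \<ge> N" for n
      using N[OF that] by (intro C0_norm_leI) (simp add: apply_f less_imp_le)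
    then show "\<exists>N. \<forall>n\<ge>N. norm (F n - Abs_C0 f) < e" using \<open>0 < e\<close> by fastforce
  qed
  then show "convergent F" by (rule convergentI)
qed

instantiation C0 :: complex_banach
begin

lift_definition scaleC_C0 :: "complex \<Rightarrow> C0 \<Rightarrow> C0" is "\<lambda>c f x. c * f x"
  by (simp add: vanishes_at_infinity_on_scale continuous_on_mult)

lemma C0_apply_scaleC [simp]: "C0_apply (c *\<^sub>C f) x = c * C0_apply f x"
  by transfer simp

instance
proof
  fix c d :: complex and r :: real and f g :: C0
  show "c *\<^sub>C (f + g) = c *\<^sub>C f + c *\<^sub>C g"
    and "(c + d) *\<^sub>C f = c *\<^sub>C f + d *\<^sub>C f"
    and "c *\<^sub>C d *\<^sub>C f = (c * d) *\<^sub>C f"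
    and "r *\<^sub>R f = complex_of_real r *\<^sub>C f"
    by (auto intro!: C0_eqI simp: algebra_simps)
  have scale_le: "norm (a *\<^sub>C h) \<le> cmod a * norm h" for a and h :: C0
    by (rule C0_norm_leI) (simp add: norm_mult mult_left_mono C0_apply_le_norm)
  show "norm (c *\<^sub>C f) = cmod c * norm f"
  proof (cases "c = 0")
    case True
    then show ?thesis using scale_le[of c f] by simp
  next
    case False
    have "f = inverse c *\<^sub>C c *\<^sub>C f" by (rule C0_eqI) (simp add: False)
    then have "norm f \<le> cmod (inverse c) * norm (c *\<^sub>C f)" using scale_le by metis
    then have "cmod c * norm f \<le> norm (c *\<^sub>C f)"
      using False by (simp add: norm_divide inverse_eq_divide pos_le_divide_eq mult.commute)
    then show ?thesis using scale_le[of c f] by simp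
  qed
qed

end

definition point_evaluation :: "complex \<Rightarrow> C0 \<Rightarrow> complex" where
  "point_evaluation x f = C0_apply f x"

lemma bounded_clinear_point_evaluation: "bounded_clinear (point_evaluation x)"
  unfolding bounded_clinear_def point_evaluation_def
proof (intro conjI allI)
  show "bounded_linear (\<lambda>f. C0_apply f x)"
    by (rule bounded_linear_intro[where K = 1])
      (simp_all add: scaleR_conv_of_real C0_apply_le_norm)
qed (simp add: scaleC_complex_def)

text \<open>\<^const>\<open>Abs_C0\<close> is only meaningful where its argument belongs to the space, that is, where
  the flow is continuous on the phase space.\<close>

definition T0 :: "real \<Rightarrow> C0 \<Rightarrow> C0" where
  "T0 t f = Abs_C0 (\<lambda>x. if x \<in> phase_space then C0_apply f (flow t x) else 0)"

end

theory Submission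
  imports Defs "HOL-Real_Asymp.Real_Asymp"
begin

text \<open>For large \<open>s\<close> the curve follows the homoclinic orbit: if \<open>2 * k\<^sup>2 + 1\<close> is the number of this
  form nearest to \<open>s\<close>, then \<open>curve (s + t)\<close> is close to \<open>homoclinic (s + t - (2 * k\<^sup>2 + 1))\<close>. This gives continuity of the flow at
  the circle, and it shows that the orbit of \<open>curve 0\<close> meets a compact subset \<open>K\<close> of \<open>phase_space - {1}\<close>
  only within a bounded distance of the return times \<open>2 * k\<^sup>2 + 1\<close>, which are the values of the
  polynomial \<open>2 * n\<^sup>2 - 4 * n + 3\<close>. The times \<open>n\<close> at distance more than \<open>sqrt k\<close> from every
  \<open>2 * k\<^sup>2 + 1\<close> have density 1. Any infinite set of such times contains arbitrarily large finite
  subsets \<open>J\<close> for which no point of the phase space is in \<open>K\<close> at more than two times in \<open>J\<close>, and this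
  forces the powers of the operator to tend weakly to zero along these times.\<close>

section \<open>The circle and the curve\<close>

lemma norm_cis_diff_1_le: "cmod (cis a - 1) \<le> \<bar>a\<bar>"
  using dist_exp_i_1[of a] abs_sin_x_le_abs_x[of "a / 2"]
  by (simp add: cis_conv_exp mult.commute)

text \<open>The argument of \<open>homoclinic t\<close> has absolute value pi / (1 + |t|), and a
  chord is no longer than its arc.\<close>

lemma dist_homoclinic_1_le: "dist (homoclinic t) 1 \<le> pi / (1 + \<bar>t\<bar>)"
proof (cases "0 \<le> t")
  case True
  then show ?thesis
    using norm_cis_diff_1_le[of "pi / (t + 1)"] by (simp add: homoclinic_def dist_norm add.commute)
next
  case False
  then have "\<bar>pi / (t - 1)\<bar> = pi / (1 + \<bar>t\<bar>)" by (simp add: abs_divide)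
  then show ?thesis
    using False norm_cis_diff_1_le[of "pi / (t - 1)"] by (simp add: homoclinic_def dist_norm)
qed

lemma dist_homoclinic_1_lessE:
  assumes "0 < e"
  obtains R where "0 < R" "\<And>t. R \<le> \<bar>t\<bar> \<Longrightarrow> dist (homoclinic t) 1 < e"
proof
  show "0 < pi / e" using assms by simp
  show "dist (homoclinic t) 1 < e" if "pi / e \<le> \<bar>t\<bar>" for t
  proof -
    have "pi \<le> e * \<bar>t\<bar>" using that assms by (simp add: field_simps)
    then have "pi / (1 + \<bar>t\<bar>) < e"
      using assms by (simp add: pos_divide_less_eq distrib_left add_pos_nonneg)
    then show ?thesis using dist_homoclinic_1_le[of t] by linarith
  qed
qed

lemma continuous_on_homoclinic: "continuous_on UNIV homoclinic"
proof -
  have "homoclinic = (\<lambda>t. if 0 \<le> t then cis (pi / (t + 1)) else cis (pi / (t - 1)))"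
    by (rule ext) (simp add: homoclinic_def)
  moreover have "continuous_on ({0..} \<union> {..0})
      (\<lambda>t. if 0 \<le> t then cis (pi / (t + 1)) else cis (pi / (t - 1)))"
    by (rule continuous_on_cases) (auto intro!: continuous_intros simp flip: cis_inverse)
  moreover have "{0..} \<union> {..0} = (UNIV :: real set)" by auto
  ultimately show ?thesis by (simp only:)
qed

text \<open>Times with |s| >= R are sent close to 1, hence away from \<open>homoclinic s0\<close>.
  The times left over that differ from \<open>s0\<close> by at least \<open>e\<close> form a compact
  set, whose image misses \<open>homoclinic s0\<close> by injectivity. This is needed because
  \<open>flow\<close> recovers the time of a point from the point.\<close>

lemma homoclinic_near_imp_near:
  assumes "0 < e"
  obtains d where "0 < d" "\<And>s. dist (homoclinic s) (homoclinic s0) < d \<Longrightarrow> \<bar>s - s0\<bar> < e"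
proof -
  \<comment> \<open>With half the distance to 1, a point within \<open>c\<close> of
    \<open>homoclinic s0\<close> cannot also be within \<open>c\<close> of 1.\<close>
  define c where "c = dist (homoclinic s0) 1 / 2"
  have c: "0 < c" by (simp add: c_def homoclinic_neq_1)
  obtain R where R: "\<And>t. R \<le> \<bar>t\<bar> \<Longrightarrow> dist (homoclinic t) 1 < c"
    using dist_homoclinic_1_lessE[OF c] by blast
  define A where "A = {- R..R} - {s0 - e <..< s0 + e}"
  have "compact A" unfolding A_def by (intro compact_diff) auto
  then have "closed (homoclinic ` A)"
    using continuous_on_subset[OF continuous_on_homoclinic]
    by (intro compact_imp_closed compact_continuous_image) auto
  moreover have "homoclinic s0 \<notin> homoclinic ` A"
    using assms by (auto simp: A_def inj_eq[OF inj_homoclinic])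
  ultimately obtain d where d: "0 < d" "\<forall>x\<in>homoclinic ` A. d \<le> dist (homoclinic s0) x"
    by (rule separate_point_closed[THEN exE]) auto
  show thesis
  proof
    show "0 < min d c" using c d by simp
    fix s assume near: "dist (homoclinic s) (homoclinic s0) < min d c"
    have "dist (homoclinic s0) 1 \<le> dist (homoclinic s) (homoclinic s0) + dist (homoclinic s) 1"
      by (metis dist_commute dist_triangle)
    then have "\<not> dist (homoclinic s) 1 < c" using near unfolding c_def by linarith
    then have "\<not> R \<le> \<bar>s\<bar>" using R by blast
    moreover have "s \<notin> A" using near d by (auto simp: dist_commute)
    ultimately show "\<bar>s - s0\<bar> < e" by (auto simp: A_def)
  qed
qed

section \<open>Continuity of the angle and of the curve\<close>

text \<open>The bound is the right end of block k + 2, so the induction adds one block at a time,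
  the base case ending at 11 with block 2. The formulas agree at common end points, so continuity on
  the closed pieces glues.\<close>

lemma continuous_on_omega_upto: "continuous_on {..2 * (real k + 2)\<^sup>2 + (real k + 2) + 1} omega"
proof (induction k)
  have block: "continuous_on {2 * real k ^ 2 - 3 * real k + 2..2 * real k ^ 2 + real k + 1} omega"
    if k: "2 \<le> k" for k :: nat
  proof -
    let ?a = "2 * real k ^ 2 - 3 * real k + 2" and ?b = "2 * real k ^ 2 - real k + 2"
    let ?c = "2 * real k ^ 2 + 1" and ?d = "2 * real k ^ 2 + real k + 1"
    have "continuous_on {?a..?b} omega"
      by (subst continuous_on_cong[OF refl omega_linear[OF k]])
        (use k in \<open>auto intro!: continuous_intros\<close>)
    moreover have "continuous_on {?b..?c} omega"
      by (subst continuous_on_cong[OF refl omega_approach[OF k]])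
        (use k in \<open>auto intro!: continuous_intros\<close>)
    moreover have "continuous_on {?c..?d} omega"
      by (subst continuous_on_cong[OF refl omega_depart[OF k]])
        (use k in \<open>auto intro!: continuous_intros\<close>)
    moreover have "{?a..?d} = {?a..?b} \<union> ({?b..?c} \<union> {?c..?d})"
      using k by auto
    ultimately show ?thesis
      by (simp only: continuous_on_closed_Un closed_atLeastAtMost closed_Un)
  qed
  {
    case 0
    have "continuous_on {..3} omega"
      by (subst continuous_on_cong[OF refl omega_le_3]) (auto intro!: continuous_intros)
    moreover have "continuous_on {3..4} omega"
      by (subst continuous_on_cong[OF refl omega_3_4]) (auto intro!: continuous_intros)
    moreover have "{..11::real} = {..3} \<union> ({3..4} \<union> {4..11})" by auto
    moreover have "continuous_on {4..11} omega" using block[of 2] by simp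
    ultimately have "continuous_on {..11} omega"
      by (simp only: continuous_on_closed_Un closed_atLeastAtMost closed_atMost closed_Un)
    then show ?case by simp
  next
    case (Suc k)
    let ?e = "2 * (real k + 2)\<^sup>2 + (real k + 2) + 1"
    let ?d = "2 * (real (Suc k) + 2)\<^sup>2 + (real (Suc k) + 2) + 1"
    \<comment> \<open>Block k + 3 starts exactly where block k + 2 ends.\<close>
    have e: "2 * real (k + 3) ^ 2 - 3 * real (k + 3) + 2 = ?e"
      by (simp add: power2_eq_square algebra_simps)
    have d: "2 * real (k + 3) ^ 2 + real (k + 3) + 1 = ?d"
      by (simp add: power2_eq_square algebra_simps)
    have "continuous_on {?e..?d} omega" using block[of "k + 3"] unfolding e d by linarith
    moreover have "?e \<le> ?d" by (simp add: power2_eq_square algebra_simps)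
    then have "{..?d} = {..?e} \<union> {?e..?d}" by auto
    ultimately show ?case
      using Suc by (simp only: continuous_on_closed_Un closed_atLeastAtMost closed_atMost)
  }
qed

lemma continuous_on_omega: "continuous_on UNIV omega"
proof -
  have "isCont omega t" for t
  proof -
    obtain k :: nat where k: "t < real k" using reals_Archimedean2 by blast
    then have "t < 2 * (real k + 2)\<^sup>2 + (real k + 2) + 1"
      by (rule less_le_trans) (simp add: power2_eq_square algebra_simps)
    then have "t \<in> interior {..2 * (real k + 2)\<^sup>2 + (real k + 2) + 1}" by simp
    then show ?thesis
      using continuous_on_omega_upto continuous_on_interior by blast
  qed
  then show ?thesis by (simp add: continuous_on_eq_continuous_at)
qed

lemma continuous_on_radius: "continuous_on UNIV radius"
proof -
  have "radius = (\<lambda>t. if 1 \<le> t then 1 - 1 / (2 * t) else exp (t - 1) / 2)"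
    by (rule ext) (simp add: radius_def)
  moreover have "continuous_on ({1..} \<union> {..1})
      (\<lambda>t::real. if 1 \<le> t then 1 - 1 / (2 * t) else exp (t - 1) / 2)"
    by (rule continuous_on_cases) (auto intro!: continuous_intros)
  moreover have "{1..} \<union> {..1} = (UNIV :: real set)" by auto
  ultimately show ?thesis by (simp only:)
qed

lemma continuous_on_curve: "continuous_on UNIV curve"
  unfolding curve_def
  by (intro continuous_intros continuous_on_radius continuous_on_compose2[OF continuous_on_cis continuous_on_omega])
    auto

section \<open>Shadowing of the homoclinic orbit by the curve\<close>

text \<open>On the approaching and departing pieces of block \<open>k\<close> the two points
  coincide. On the linear pieces of blocks \<open>k\<close> and k + 1 both are within pi / k of 1.
  The upper limit for \<open>u\<close> is the end of the linear piece of block k + 1.\<close>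

lemma dist_cis_homoclinic:
  fixes k :: nat
  assumes k: "2 \<le> k" and lower: "2 * real k ^ 2 - 3 * real k + 2 \<le> u"
    and upper: "u \<le> 2 * real k ^ 2 + 3 * real k + 3"
  shows "dist (cis (omega u)) (homoclinic (u - (2 * real k ^ 2 + 1))) \<le> 2 * pi / real k"
proof -
  let ?v = "u - (2 * real k ^ 2 + 1)"
  have cis_per: "cis (- (2 * real j) * pi + a) = cis a" for j :: nat and a
    using cis_multiple_2pi[of "- real j"] cis_mult[of "- (2 * real j) * pi" a] by (simp add: mult_ac)
  \<comment> \<open>This serves both linear pieces, with \<open>j\<close> equal to \<open>k\<close>
    or k + 1 and \<open>x\<close> the numerator in the formula for \<open>omega\<close>.\<close>
  have close_1: "dist (cis (omega u)) (homoclinic ?v) \<le> 2 * pi / real k"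
    if j: "2 \<le> j" and kj: "k \<le> j" and om: "omega u = - (2 * real j) * pi + x / real j ^ 2 * pi"
      and x: "\<bar>x\<bar> \<le> real j" and v: "real k \<le> 1 + \<bar>?v\<bar>" for j :: nat and x
  proof -
    have "\<bar>x / real j ^ 2 * pi\<bar> \<le> pi / real j"
      using x j by (simp add: abs_mult divide_simps power2_eq_square)
    also have "\<dots> \<le> pi / real k" using k kj by (intro divide_left_mono) auto
    finally have "dist (cis (omega u)) 1 \<le> pi / real k"
      unfolding om cis_per dist_norm using norm_cis_diff_1_le order_trans by blast
    moreover have "pi / (1 + \<bar>?v\<bar>) \<le> pi / real k"
      using k v by (intro divide_left_mono) auto
    then have "dist (homoclinic ?v) 1 \<le> pi / real k"
      using dist_homoclinic_1_le[of ?v] by linarith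
    ultimately show ?thesis
      using dist_triangle2[of "cis (omega u)" "homoclinic ?v" 1] by simp
  qed
  consider "u \<le> 2 * real k ^ 2 - real k + 2"
    | "2 * real k ^ 2 - real k + 2 \<le> u" "u < 2 * real k ^ 2 + 1"
    | "2 * real k ^ 2 + 1 \<le> u" "u \<le> 2 * real k ^ 2 + real k + 1"
    | "2 * real k ^ 2 + real k + 1 \<le> u" by linarith
  then show ?thesis
  proof cases
    case 1
    then show ?thesis
      using omega_linear[OF k lower] lower
      by (intro close_1[where j = k and x = "2 * real k ^ 2 - 2 * real k + 2 - u"]) (use k in auto)
  next
    case 2
    have "omega u = - (2 * real k) * pi + pi / (?v - 1)"
      using omega_approach[OF k 2(1)] 2(2)
      by (simp add: minus_divide_right)
    then have "cis (omega u) = homoclinic ?v"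
      using 2(2) by (simp only: cis_per) (simp add: homoclinic_def)
    then show ?thesis using k by simp
  next
    case 3
    have "omega u = - (2 * real (k + 1)) * pi + pi / (?v + 1)"
      using omega_depart[OF k 3(1) 3(2)] by (simp add: algebra_simps)
    then have "cis (omega u) = homoclinic ?v"
      using 3 by (simp only: cis_per) (simp add: homoclinic_def)
    then show ?thesis using k by simp
  next
    case 4
    let ?j = "k + 1"
    have j2: "real ?j ^ 2 = real k ^ 2 + 2 * real k + 1" by (simp add: power2_eq_square algebra_simps)
    have l: "2 * real ?j ^ 2 - 3 * real ?j + 2 \<le> u" "u \<le> 2 * real ?j ^ 2 - real ?j + 2"
      unfolding j2 using 4 upper by simp_all
    show ?thesis
      using omega_linear[OF _ l] k l 4
      by (intro close_1[where j = ?j and x = "2 * real ?j ^ 2 - 2 * real ?j + 2 - u"]) auto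
  qed
qed

lemma norm_less_1_iff_phase_space:
  assumes "x \<in> phase_space"
  shows "cmod x < 1 \<longleftrightarrow> x \<in> range curve"
  using assms by (auto simp: phase_space_def norm_curve less_imp_neq[OF radius_less_1] radius_less_1)

lemma phase_space_cases:
  assumes "x \<in> phase_space"
  obtains (fixed) "x = 1" | (circle) s where "x = homoclinic s" | (curve) s where "x = curve s"
  using assms range_homoclinic unfolding phase_space_def by blast

lemma one_in_phase_space: "1 \<in> phase_space"
  by (simp add: phase_space_def)

lemma homoclinic_in_phase_space: "homoclinic t \<in> phase_space"
  by (simp add: phase_space_def norm_homoclinic)

lemma curve_in_phase_space: "curve t \<in> phase_space"
  by (simp add: phase_space_def)

lemma curve_neq_1: "curve t \<noteq> 1"
  using norm_curve[of t] radius_less_1[of t] by auto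

lemma zero_notin_phase_space: "0 \<notin> phase_space"
proof
  assume "0 \<in> phase_space"
  then obtain t where "curve t = 0" by (auto simp: phase_space_def)
  then show False using norm_curve[of t] radius_pos[of t] by simp
qed

lemma dist_curve_cis:
  assumes "1 \<le> u"
  shows "dist (curve u) (cis (omega u)) = 1 / (2 * u)"
proof -
  have "curve u - cis (omega u) = complex_of_real (radius u - 1) * cis (omega u)"
    by (simp add: curve_def algebra_simps)
  then have "dist (curve u) (cis (omega u)) = \<bar>radius u - 1\<bar>"
    by (simp add: dist_norm norm_mult del: of_real_diff)
  then show ?thesis using assms by (simp add: radius_def)
qed

text \<open>The error splits into the radial gap 1 / (2 u), with u = s + t, and the angular error 2
  pi / k. A single \<open>k\<close> serves the whole window |t| <= T, so that a point and its shadow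
  can be flowed together.\<close>

lemma curve_shadows_homoclinic:
  assumes e: "0 < e"
  obtains S where "\<And>s. S \<le> s \<Longrightarrow>
    \<exists>k::nat. \<forall>t. \<bar>t\<bar> \<le> T \<longrightarrow> dist (curve (s + t)) (homoclinic (s + t - (2 * real k ^ 2 + 1))) < e"
proof -
  \<comment> \<open>The three bounds give k >= 2, T <= k and 2 pi / k < e / 2 for every k >= k0.
    Below, the first entry of \<open>S\<close> forces k >= k0 and the second makes the radial gap
    smaller than e / 2.\<close>
  obtain k0 :: nat where k0: "max (max 2 T) (4 * pi / e + 1) \<le> real k0"
    using real_arch_simple by blast
  define S where "S = max (2 * real k0 ^ 2 + 2 * real k0 + 2) (1 / e + \<bar>T\<bar> + 1)"
  show thesis
  proof
    fix s assume s: "S \<le> s"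
    define k where "k = (LEAST k::nat. s \<le> 2 * real k ^ 2 + 2 * real k + 2)"
    obtain j :: nat where "s \<le> real j" using real_arch_simple by blast
    then have "s \<le> 2 * real j ^ 2 + 2 * real j + 2" by (rule order_trans) simp
    then have upper: "s \<le> 2 * real k ^ 2 + 2 * real k + 2"
      unfolding k_def by (rule LeastI)
    have "k0 \<le> k"
    proof (rule ccontr)
      assume "\<not> k0 \<le> k"
      then have "real k < real k0" by simp
      moreover from this have "real k ^ 2 < real k0 ^ 2" by (intro power_strict_mono) auto
      ultimately show False using upper s unfolding S_def by linarith
    qed
    then have k: "2 \<le> real k" "T \<le> real k" "4 * pi / e + 1 \<le> real k" using k0 by auto
    have "2 * pi / real k < e / 2"
      using k(3) e k(1) by (simp add: field_simps)
    \<comment> \<open>Minimality of \<open>k\<close> leaves \<open>s\<close> between 2 k^2 - 2 k + 2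
      and 2 k^2 + 2 k + 2; moving it by at most T <= k stays in the range of
      \<open>dist_cis_homoclinic\<close>.\<close>
    have "\<not> s \<le> 2 * real (k - 1) ^ 2 + 2 * real (k - 1) + 2"
      by (rule not_less_Least) (use k in \<open>simp flip: k_def\<close>)
    moreover have "2 * real (k - 1) ^ 2 + 2 * real (k - 1) + 2 = 2 * real k ^ 2 - 2 * real k + 2"
      using k by (simp add: of_nat_diff power2_eq_square algebra_simps)
    ultimately have lower: "2 * real k ^ 2 - 2 * real k + 2 \<le> s" by simp
    have "dist (curve (s + t)) (homoclinic (s + t - (2 * real k ^ 2 + 1))) < e" if t: "\<bar>t\<bar> \<le> T" for t
    proof -
      have u: "1 / e + 1 \<le> s + t" using s t unfolding S_def by linarith
      moreover have "0 < 1 / e" using e by simp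
      ultimately have "1 \<le> s + t" by linarith
      then have "dist (curve (s + t)) (cis (omega (s + t))) = 1 / (2 * (s + t))"
        by (rule dist_curve_cis)
      also have "\<dots> < e / 2"
      proof -
        have "1 < (s + t) * e" using u e by (simp add: field_simps)
        then show ?thesis using \<open>1 \<le> s + t\<close> by (simp add: field_simps)
      qed
      finally have "dist (curve (s + t)) (cis (omega (s + t))) < e / 2" .
      moreover have "dist (cis (omega (s + t))) (homoclinic (s + t - (2 * real k ^ 2 + 1))) \<le> 2 * pi / real k"
        by (rule dist_cis_homoclinic) (use k lower upper t in auto)
      ultimately show ?thesis
        using \<open>2 * pi / real k < e / 2\<close>
          dist_triangle[of "curve (s + t)" "homoclinic (s + t - (2 * real k ^ 2 + 1))" "cis (omega (s + t))"]
        by linarith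
    qed
    then show "\<exists>k::nat. \<forall>t. \<bar>t\<bar> \<le> T \<longrightarrow>
        dist (curve (s + t)) (homoclinic (s + t - (2 * real k ^ 2 + 1))) < e" by blast
  qed
qed

section \<open>Continuity of the flow\<close>

lemma flow_add:
  assumes "x \<in> phase_space"
  shows "flow t (flow s x) = flow (s + t) x"
  using assms by (cases rule: phase_space_cases) (simp_all add: flow_1 flow_homoclinic flow_curve add_ac)

lemma flow_0: "x \<in> phase_space \<Longrightarrow> flow 0 x = x"
  by (elim phase_space_cases) (simp_all add: flow_1 flow_homoclinic flow_curve)

lemma flow_in_phase_space: "x \<in> phase_space \<Longrightarrow> flow t x \<in> phase_space"
  by (elim phase_space_cases)
    (simp_all add: one_in_phase_space flow_1 flow_homoclinic flow_curve homoclinic_in_phase_space curve_in_phase_space)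

lemma flow_eq_1_iff: "x \<in> phase_space \<Longrightarrow> flow t x = 1 \<longleftrightarrow> x = 1"
  by (elim phase_space_cases)
    (simp_all add: flow_1 flow_homoclinic flow_curve homoclinic_neq_1 curve_neq_1)

text \<open>At the fixed point, nearby points of the circle have times so large that a bounded shift
  keeps them near 1. Elsewhere the flow is a translation of times, and times depend continuously on
  points.\<close>

lemma flow_continuous_circle:
  assumes x0: "x0 \<in> sphere 0 1" and e: "0 < e"
  obtains d where "0 < d"
    "\<And>t y. \<bar>t - t0\<bar> < d \<Longrightarrow> y \<in> sphere 0 1 \<Longrightarrow> dist y x0 < d \<Longrightarrow> dist (flow t y) (flow t0 x0) < e"
proof (cases "x0 = 1")
  case True
  obtain R where R: "\<And>t. R \<le> \<bar>t\<bar> \<Longrightarrow> dist (homoclinic t) 1 < e"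
    using dist_homoclinic_1_lessE[OF e] by blast
  \<comment> \<open>The margin |t0| + 1 absorbs every time shift \<open>t\<close> with |t - t0| <
    1.\<close>
  define M where "M = R + \<bar>t0\<bar> + 1"
  have "closed (homoclinic ` {- M..M})"
    using continuous_on_subset[OF continuous_on_homoclinic]
    by (intro compact_imp_closed compact_continuous_image) auto
  moreover have "1 \<notin> homoclinic ` {- M..M}" using homoclinic_neq_1 by (metis imageE)
  ultimately obtain d where d: "0 < d" "\<forall>x\<in>homoclinic ` {- M..M}. d \<le> dist 1 x"
    by (rule separate_point_closed[THEN exE]) auto
  show thesis
  proof
    show "0 < min d 1" using d by simp
    fix t y assume t: "\<bar>t - t0\<bar> < min d 1" and y: "y \<in> sphere 0 1" and near: "dist y x0 < min d 1"
    show "dist (flow t y) (flow t0 x0) < e"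
    proof (cases "y = 1")
      case False
      then obtain s where s: "y = homoclinic s" using y range_homoclinic by blast
      have "\<not> d \<le> dist 1 y" using near True by (simp add: dist_commute)
      then have "s \<notin> {- M..M}" using d(2) s by blast
      then have "R \<le> \<bar>s + t\<bar>" using t unfolding M_def by auto
      then show ?thesis using R True s by (simp add: flow_1 flow_homoclinic)
    qed (use True e in \<open>simp add: flow_1\<close>)
  qed
next
  case False
  then obtain s0 where s0: "x0 = homoclinic s0" using x0 range_homoclinic by blast
  have "isCont homoclinic (s0 + t0)"
    using continuous_on_homoclinic by (simp add: continuous_on_eq_continuous_at)
  then obtain c where c: "0 < c" "\<And>s. dist s (s0 + t0) < c \<Longrightarrow> dist (homoclinic s) (homoclinic (s0 + t0)) < e"
    using e unfolding continuous_at_eps_delta dist_norm by blast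
  have "0 < c / 2" using c by simp
  then obtain d where d: "0 < d" "\<And>s. dist (homoclinic s) (homoclinic s0) < d \<Longrightarrow> \<bar>s - s0\<bar> < c / 2"
    using homoclinic_near_imp_near by blast
  show thesis
  proof
    show "0 < min (min d (c / 2)) (dist 1 x0)" using c d False by simp
    fix t y assume t: "\<bar>t - t0\<bar> < min (min d (c / 2)) (dist 1 x0)" and y: "y \<in> sphere 0 1"
      and near: "dist y x0 < min (min d (c / 2)) (dist 1 x0)"
    have "y \<noteq> 1" using near by auto
    then obtain s where s: "y = homoclinic s" using y range_homoclinic by blast
    have "\<bar>s - s0\<bar> < c / 2" using near d(2) s s0 by simp
    then have "dist (s + t) (s0 + t0) < c" using t by (simp add: dist_real_def abs_if split: if_splits)
    then show "dist (flow t y) (flow t0 x0) < e" using c(2) s s0 by (simp add: flow_homoclinic)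
  qed
qed

text \<open>The modulus of a curve point is its radius, which is strictly increasing in the
  parameter, so the modulus alone locates the parameter.\<close>

lemma curve_near_imp_near:
  assumes "0 < e"
  obtains d where "0 < d" "\<And>s. dist (curve s) (curve s0) < d \<Longrightarrow> \<bar>s - s0\<bar> < e"
proof
  let ?d = "min (radius s0 - radius (s0 - e)) (radius (s0 + e) - radius s0)"
  show "0 < ?d" using assms by (simp add: radius_strict_mono)
  fix s assume "dist (curve s) (curve s0) < ?d"
  moreover have "\<bar>radius s - radius s0\<bar> \<le> dist (curve s) (curve s0)"
    using norm_triangle_ineq3[of "curve s" "curve s0"] by (simp add: norm_curve dist_norm)
  ultimately have "radius (s0 - e) < radius s" "radius s < radius (s0 + e)" by linarith+
  then have "\<not> s \<le> s0 - e" "\<not> s0 + e \<le> s"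
    using radius_strict_mono by (metis less_eq_real_def order_less_asym order_less_irrefl)+
  then show "\<bar>s - s0\<bar> < e" by linarith
qed

text \<open>The delicate case is a base point on the circle approached along the curve: the curve
  point is replaced by its shadow on the circle, which stays close to it under the flow, and
  continuity on the circle applies to the shadow.\<close>

lemma continuous_on_flow: "continuous_on (UNIV \<times> phase_space) (\<lambda>(t, x). flow t x)"
  unfolding continuous_on_iff
proof (intro ballI allI impI)
  fix p :: "real \<times> complex" and e :: real
  assume p: "p \<in> UNIV \<times> phase_space" and e: "0 < e"
  obtain t0 x0 where p_eq: "p = (t0, x0)" by (cases p)
  have x0: "x0 \<in> phase_space" using p p_eq by simp
  have "\<exists>d>0. \<forall>t. \<forall>x\<in>phase_space. \<bar>t - t0\<bar> < d \<longrightarrow> dist x x0 < d \<longrightarrow> dist (flow t x) (flow t0 x0) < e"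
  proof (cases "cmod x0 = 1")
    case True
    then have "x0 \<in> sphere 0 1" by simp
    moreover have "0 < e / 2" using e by simp
    ultimately obtain d where d: "0 < d" "\<And>t y. \<bar>t - t0\<bar> < d \<Longrightarrow> y \<in> sphere 0 1 \<Longrightarrow> dist y x0 < d \<Longrightarrow>
        dist (flow t y) (flow t0 x0) < e / 2"
      using flow_continuous_circle[of x0 "e / 2" t0] by metis
    have "0 < min (e / 2) (d / 2)" using e d by simp
    then obtain S where S: "\<And>s. S \<le> s \<Longrightarrow> \<exists>k::nat. \<forall>t. \<bar>t\<bar> \<le> \<bar>t0\<bar> + 1 \<longrightarrow>
        dist (curve (s + t)) (homoclinic (s + t - (2 * real k ^ 2 + 1))) < min (e / 2) (d / 2)"
      using curve_shadows_homoclinic[where T = "\<bar>t0\<bar> + 1"] by blast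
    \<comment> \<open>The bound d / 2 leaves room for the distance from \<open>x\<close> to its
      shadow, 1 keeps |t| <= |t0| + 1, and 1 - radius S forces the parameter of a nearby curve point
      to be at least \<open>S\<close>.\<close>
    let ?d = "min (min (d / 2) 1) (1 - radius S)"
    have "0 < ?d" using d radius_less_1 by simp
    moreover have "dist (flow t x) (flow t0 x0) < e"
      if t: "\<bar>t - t0\<bar> < ?d" and x: "x \<in> phase_space" and near: "dist x x0 < ?d" for t x
    proof (cases "cmod x = 1")
      case True
      then have "x \<in> sphere 0 1" by simp
      then have "dist (flow t x) (flow t0 x0) < e / 2" using d t near by (intro d(2)) auto
      then show ?thesis using e by linarith
    next
      case False
      then obtain s where s: "x = curve s" using x by (auto simp: phase_space_def)
      have "\<bar>radius s - 1\<bar> \<le> dist x x0"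
        using norm_triangle_ineq3[of x x0] True by (simp add: s norm_curve dist_norm)
      then have "radius S < radius s" using near by linarith
      then have "S \<le> s" using radius_strict_mono[of s S] by linarith
      then obtain k :: nat where k: "\<And>t. \<bar>t\<bar> \<le> \<bar>t0\<bar> + 1 \<Longrightarrow>
          dist (curve (s + t)) (homoclinic (s + t - (2 * real k ^ 2 + 1))) < min (e / 2) (d / 2)"
        using S by blast
      define y where "y = homoclinic (s - (2 * real k ^ 2 + 1))"
      have "dist x y < d / 2" using k[of 0] by (simp add: s y_def)
      then have "dist y x0 < d"
        using near dist_triangle3[of y x0 x] by simp
      moreover have "\<bar>t - t0\<bar> < d" using t d(1) by simp
      ultimately have "dist (flow t y) (flow t0 x0) < e / 2"
        by (intro d(2)) (simp_all add: y_def norm_homoclinic)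
      moreover have "\<bar>t\<bar> \<le> \<bar>t0\<bar> + 1" using t by linarith
      then have "dist (flow t x) (flow t y) < e / 2"
        using k[of t] by (simp add: s y_def flow_curve flow_homoclinic diff_add_eq)
      ultimately show ?thesis using dist_triangle[of "flow t x" "flow t0 x0" "flow t y"] by linarith
    qed
    ultimately show ?thesis by blast
  next
    case False
    then obtain s0 where s0: "x0 = curve s0" using x0 by (auto simp: phase_space_def)
    have "isCont curve (s0 + t0)"
      using continuous_on_curve by (simp add: continuous_on_eq_continuous_at)
    then obtain c where c: "0 < c" "\<And>s. dist s (s0 + t0) < c \<Longrightarrow> dist (curve s) (curve (s0 + t0)) < e"
      using e unfolding continuous_at_eps_delta dist_norm by blast
    have "0 < c / 2" using c by simp
    then obtain d where d: "0 < d" "\<And>s. dist (curve s) (curve s0) < d \<Longrightarrow> \<bar>s - s0\<bar> < c / 2"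
      using curve_near_imp_near by blast
    \<comment> \<open>The last bound keeps nearby points inside the open disk, hence on the
      curve.\<close>
    let ?d = "min (min d (c / 2)) (1 - cmod x0)"
    have "0 < ?d" using c d by (simp add: s0 norm_curve radius_less_1)
    moreover have "dist (flow t x) (flow t0 x0) < e"
      if t: "\<bar>t - t0\<bar> < ?d" and x: "x \<in> phase_space" and near: "dist x x0 < ?d" for t x
    proof -
      have "cmod x < 1" using near norm_triangle_ineq3[of x x0] unfolding dist_norm by linarith
      then obtain s where s: "x = curve s" using x norm_less_1_iff_phase_space by blast
      have "\<bar>s - s0\<bar> < c / 2" using near d(2) s s0 by simp
      then have "dist (s + t) (s0 + t0) < c" using t by (simp add: dist_real_def abs_if split: if_splits)
      then show ?thesis using c(2) s s0 by (simp add: flow_curve)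
    qed
    ultimately show ?thesis by blast
  qed
  then obtain d where d: "0 < d" "\<And>t x. x \<in> phase_space \<Longrightarrow> \<bar>t - t0\<bar> < d \<Longrightarrow> dist x x0 < d \<Longrightarrow>
      dist (flow t x) (flow t0 x0) < e" by blast
  have "dist (case q of (t, x) \<Rightarrow> flow t x) (case p of (t, x) \<Rightarrow> flow t x) < e"
    if q: "q \<in> UNIV \<times> phase_space" "dist q p < d" for q
  proof -
    obtain t x where q_eq: "q = (t, x)" by (cases q)
    have "dist t t0 \<le> dist q p" "dist x x0 \<le> dist q p"
      using dist_fst_le[of q p] dist_snd_le[of q p] by (simp_all add: p_eq q_eq)
    then show ?thesis using q d(2)[of x t] by (simp add: p_eq q_eq dist_real_def)
  qed
  with d(1) show "\<exists>d>0. \<forall>q\<in>UNIV \<times> phase_space. dist q p < d \<longrightarrow>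
      dist (case q of (t, x) \<Rightarrow> flow t x) (case p of (t, x) \<Rightarrow> flow t x) < e" by blast
qed

lemma continuous_flow: "continuous_flow_on phase_space flow"
  unfolding continuous_flow_on_def
  using continuous_on_flow flow_in_phase_space by (auto simp: flow_0 flow_add)

lemma continuous_on_flow_time: "continuous_on phase_space (flow t)"
proof -
  have "continuous_on phase_space ((\<lambda>(t, x). flow t x) \<circ> Pair t)"
    by (intro continuous_on_compose continuous_on_subset[OF continuous_on_flow] continuous_intros) auto
  then show ?thesis by (simp add: comp_def)
qed

section \<open>Times at which orbits meet a compact set\<close>

text \<open>\<open>K\<close> has positive distance from 1 and from 0. Far along the curve the shadow
  must stay away from 1, which bounds its homoclinic time; backwards the curve tends to 0, which
  bounds the time from below.\<close>

lemma compact_return_times: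
  assumes K: "compact K" "K \<subseteq> phase_space - {1}"
  obtains R where "0 < R" "\<And>t. curve t \<in> K \<Longrightarrow> \<exists>k::nat. \<bar>t - (2 * real k ^ 2 + 1)\<bar> \<le> R"
    "\<And>t. homoclinic t \<in> K \<Longrightarrow> \<bar>t\<bar> \<le> R"
proof -
  have "closed K" "1 \<notin> K" "0 \<notin> K" using K compact_imp_closed zero_notin_phase_space by auto
  then obtain d1 d0 where d1: "0 < d1" "\<And>x. x \<in> K \<Longrightarrow> d1 \<le> dist 1 x"
    and d0: "0 < d0" "\<And>x. x \<in> K \<Longrightarrow> d0 \<le> dist 0 x"
    using separate_point_closed[of K 1] separate_point_closed[of K 0] by blast
  have "0 < d1 / 2" using d1 by simp
  then obtain R where R: "0 < R" "\<And>t. R \<le> \<bar>t\<bar> \<Longrightarrow> dist (homoclinic t) 1 < d1 / 2"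
    by (rule dist_homoclinic_1_lessE) blast
  obtain S where S: "\<And>s. S \<le> s \<Longrightarrow> \<exists>k::nat. \<forall>t. \<bar>t\<bar> \<le> 0 \<longrightarrow>
        dist (curve (s + t)) (homoclinic (s + t - (2 * real k ^ 2 + 1))) < d1 / 2"
    using curve_shadows_homoclinic[OF \<open>0 < d1 / 2\<close>, where T = 0] by blast
  let ?R = "R + \<bar>S\<bar> + \<bar>ln d0\<bar> + 3"
  show thesis
  proof
    show "0 < ?R" using R by simp
    show "\<bar>t\<bar> \<le> ?R" if "homoclinic t \<in> K" for t
    proof -
      have "\<not> dist (homoclinic t) 1 < d1 / 2"
        using d1(1) d1(2)[OF that] unfolding dist_commute[of 1] by linarith
      then show ?thesis using R(2)[of t] by linarith
    qed
    show "\<exists>k::nat. \<bar>t - (2 * real k ^ 2 + 1)\<bar> \<le> ?R" if t: "curve t \<in> K" for t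
    proof (cases "S \<le> t")
      case True
      then obtain k :: nat where k: "dist (curve t) (homoclinic (t - (2 * real k ^ 2 + 1))) < d1 / 2"
        using S[of t] by auto
      have "\<not> dist (homoclinic (t - (2 * real k ^ 2 + 1))) 1 < d1 / 2"
        using k d1(2)[OF t] dist_triangle[of "curve t" 1 "homoclinic (t - (2 * real k ^ 2 + 1))"]
        unfolding dist_commute[of 1] by linarith
      then have "\<bar>t - (2 * real k ^ 2 + 1)\<bar> \<le> ?R" using R(2)[of "t - (2 * real k ^ 2 + 1)"] by linarith
      then show ?thesis by blast
    next
      case False
      have "min (ln d0) 1 \<le> t"
      proof (rule ccontr)
        assume "\<not> min (ln d0) 1 \<le> t"
        then have "t < 1" "t < ln d0" by simp_all
        then have "exp (t - 1) < exp (ln d0)" by (subst exp_less_cancel_iff) linarith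
        then have "radius t < d0" using \<open>t < 1\<close> d0(1) by (simp add: radius_def)
        then show False using d0(2)[OF t] by (simp add: norm_curve)
      qed
      \<comment> \<open>The remaining parameters fill a bounded interval, so the return time 1,
        given by k = 0, is near enough.\<close>
      then have "\<bar>t - (2 * real (0::nat) ^ 2 + 1)\<bar> \<le> ?R" using False R(1) by simp
      then show ?thesis by blast
    qed
  qed
qed

section \<open>Times far from the returns to $-1$\<close>

text \<open>The indices \<open>k\<close> with \<open>enumerate A k\<close> at most \<open>n\<close>
  correspond to the elements of \<open>A\<close> up to \<open>n\<close>, whose number is n + 1 (0 is
  included) minus the number of missing ones.\<close>

lemma enumerate_has_density_1:
  fixes A :: "nat set"
  assumes lim: "(\<lambda>n. real (card ({..n} - A)) / real n) \<longlonglongrightarrow> 0"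
  shows "infinite A" and "has_density (enumerate A) 1"
proof -
  show inf: "infinite A"
  proof
    assume fin: "finite A"
    have "(\<lambda>n. real (card ({..n} - A)) / real n + real (card A) / real n) \<longlonglongrightarrow> 0 + 0"
      by (intro tendsto_add lim) real_asymp
    moreover have "1 \<le> real (card ({..n} - A)) / real n + real (card A) / real n" if "1 \<le> n" for n
    proof -
      have "card {..n} \<le> card ({..n} - A) + card A"
        using fin diff_card_le_card_Diff[of A "{..n}"] by linarith
      then have "real n \<le> real (card ({..n} - A)) + real (card A)" by simp
      then show ?thesis using that by (simp add: field_simps flip: add_divide_distrib)
    qed
    ultimately have "1 \<le> (0::real)" by (intro LIMSEQ_le_const) auto
    then show False by simp
  qed
  have "real (card {k. enumerate A k \<le> n}) / real n
      = (real n + 1) / real n - real (card ({..n} - A)) / real n" for n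
  proof -
    have "enumerate A ` {k. enumerate A k \<le> n} = {..n} \<inter> A"
      by (subst (3) range_enumerate[OF inf, symmetric]) auto
    then have "card {k. enumerate A k \<le> n} = card ({..n} \<inter> A)"
      using card_image[OF inj_on_subset[OF inj_enumerate[OF inf] subset_UNIV]] by metis
    moreover have "card ({..n} \<inter> A) + card ({..n} - A) = n + 1"
      by (subst card_Un_disjoint[symmetric]) (auto simp: Int_Diff_Un)
    then have "real (card ({..n} \<inter> A)) = real n + 1 - real (card ({..n} - A))" by linarith
    ultimately show ?thesis by (simp add: diff_divide_distrib)
  qed
  moreover have "(\<lambda>n. (real n + 1) / real n - real (card ({..n} - A)) / real n) \<longlonglongrightarrow> 1 - 0"
    by (intro tendsto_diff lim) real_asymp
  ultimately show "has_density (enumerate A) 1" by (simp add: has_density_def)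
qed

text \<open>The threshold \<open>sqrt (real k)\<close> is unbounded, so far times eventually leave
  every bounded neighbourhood of the return times; it grows slowly enough that only O(n^(3/4)) times
  up to \<open>n\<close> are excluded.\<close>

definition far_times :: "nat set" where
  "far_times = {n. 1 \<le> n \<and> (\<forall>k::nat. sqrt (real k) < \<bar>real n - (2 * real k ^ 2 + 1)\<bar>)}"

text \<open>An excluded positive time is 2 k^2 + 1 + i with |i| <= sqrt k. Since sqrt k <= k^2, this
  time is at least k^2, so k <= sqrt n and |i| <= n^(1/4). The final summand 1 counts the time
  0.\<close>

lemma card_not_far_times_le:
  "real (card ({..n} - far_times)) \<le> (sqrt (real n) + 1) * (2 * sqrt (sqrt (real n)) + 1) + 1"
proof -
  define a where "a = nat \<lfloor>sqrt (real n)\<rfloor>"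
  define b where "b = \<lfloor>sqrt (sqrt (real n))\<rfloor>"
  let ?I = "{..a} \<times> {- b..b}"
  have "{..n} - far_times \<subseteq> insert 0 ((\<lambda>(k, i). nat (2 * int k ^ 2 + 1 + i)) ` ?I)"
  proof
    fix m assume m: "m \<in> {..n} - far_times"
    show "m \<in> insert 0 ((\<lambda>(k, i). nat (2 * int k ^ 2 + 1 + i)) ` ?I)"
    proof (cases "m = 0")
      case False
      then obtain k :: nat where k: "\<bar>real m - (2 * real k ^ 2 + 1)\<bar> \<le> sqrt (real k)"
        using m by (auto simp: far_times_def not_less)
      define i where "i = int m - (2 * int k ^ 2 + 1)"
      have "k \<le> k ^ 2" by (simp add: power2_eq_square)
      then have kk: "real k \<le> real k ^ 2" by (metis of_nat_le_iff of_nat_power)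
      have "sqrt (real k) \<le> sqrt (real k ^ 2)" using kk by (rule real_sqrt_le_mono)
      then have "sqrt (real k) \<le> real k" by simp
      then have "real k ^ 2 \<le> real m" using k kk by linarith
      also have "\<dots> \<le> real n" using m by simp
      finally have kn: "real k \<le> sqrt (real n)" by (rule real_le_rsqrt)
      then have "k \<le> a" unfolding a_def by (simp add: le_nat_iff le_floor_iff)
      have "real_of_int \<bar>i\<bar> \<le> sqrt (real k)" using k by (simp add: i_def)
      also have "\<dots> \<le> sqrt (sqrt (real n))" using kn by simp
      finally have "\<bar>i\<bar> \<le> b" unfolding b_def by (simp add: le_floor_iff)
      then have "(k, i) \<in> ?I" using \<open>k \<le> a\<close> by auto
      moreover have "m = (\<lambda>(k, i). nat (2 * int k ^ 2 + 1 + i)) (k, i)" by (simp add: i_def)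
      ultimately show ?thesis by blast
    qed simp
  qed
  then have "card ({..n} - far_times) \<le> card (insert 0 ((\<lambda>(k, i). nat (2 * int k ^ 2 + 1 + i)) ` ?I))"
    by (intro card_mono) auto
  also have "\<dots> \<le> Suc (card ((\<lambda>(k, i). nat (2 * int k ^ 2 + 1 + i)) ` ?I))"
    by (rule card_insert_le_m1) auto
  also have "\<dots> \<le> Suc (card ?I)" by (intro Suc_le_mono[THEN iffD2] card_image_le) simp
  finally have "real (card ({..n} - far_times)) \<le> real (Suc (card ?I))" by (rule of_nat_mono)
  also have "\<dots> = (real a + 1) * real (nat (2 * b + 1)) + 1" by (simp add: distrib_right)
  also have "\<dots> \<le> (sqrt (real n) + 1) * (2 * sqrt (sqrt (real n)) + 1) + 1"
  proof -
    have "real a \<le> sqrt (real n)" unfolding a_def by simp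
    moreover have "0 \<le> b" "real_of_int b \<le> sqrt (sqrt (real n))" unfolding b_def by simp_all
    ultimately show ?thesis by (intro add_right_mono mult_mono) auto
  qed
  finally show ?thesis .
qed

lemma far_times_density: "(\<lambda>n. real (card ({..n} - far_times)) / real n) \<longlonglongrightarrow> 0"
proof (rule tendsto_sandwich)
  show "\<forall>\<^sub>F n in sequentially. 0 \<le> real (card ({..n} - far_times)) / real n" by simp
  show "\<forall>\<^sub>F n in sequentially. real (card ({..n} - far_times)) / real n
      \<le> ((sqrt (real n) + 1) * (2 * sqrt (sqrt (real n)) + 1) + 1) / real n"
    by (intro always_eventually allI divide_right_mono card_not_far_times_le) simp
  show "(\<lambda>n. ((sqrt (real n) + 1) * (2 * sqrt (sqrt (real n)) + 1) + 1) / real n) \<longlonglongrightarrow> 0"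
    by real_asymp
qed simp

text \<open>A far time within \<open>R\<close> of 2 k^2 + 1 has sqrt k < R, hence k <= R^2, and so
  it is at most R + 2 R^4 + 1.\<close>

lemma far_times_eventually_far:
  obtains M where "\<And>n k :: nat. n \<in> far_times \<Longrightarrow> M \<le> n \<Longrightarrow> R < \<bar>real n - (2 * real k ^ 2 + 1)\<bar>"
proof -
  obtain M :: nat where M: "R + 2 * (R ^ 2) ^ 2 + 1 < real M" using reals_Archimedean2 by blast
  show thesis
  proof
    fix n k :: nat assume n: "n \<in> far_times" "M \<le> n"
    show "R < \<bar>real n - (2 * real k ^ 2 + 1)\<bar>"
    proof (rule ccontr)
      assume near: "\<not> ?thesis"
      then have "sqrt (real k) \<le> R" using n(1) by (auto simp: far_times_def dest: spec[of _ k])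
      then have "sqrt (real k) ^ 2 \<le> R ^ 2" by (intro power_mono) auto
      then have "real k \<le> R ^ 2" by simp
      then have "real k ^ 2 \<le> (R ^ 2) ^ 2" by (intro power_mono) auto
      then show False using near M n(2) by linarith
    qed
  qed
qed

section \<open>Choosing finite sets of times with few simultaneous hits\<close>

text \<open>\<open>J\<close> is built greedily. A new large element excludes triple hits with the
  pairs already chosen only if each such pair excludes almost all third elements, so this property
  of pairs is carried along in the induction.\<close>

lemma finite_subset_at_most_two_hits:
  fixes hit :: "nat \<Rightarrow> 'a \<Rightarrow> bool"
  assumes inf: "infinite A"
    and ev: "\<And>a. \<forall>\<^sub>F b in sequentially. \<forall>\<^sub>F c in sequentially. \<forall>y\<in>Y. \<not> (hit a y \<and> hit b y \<and> hit c y)"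
  obtains J where "J \<subseteq> A" "finite J" "card J = m" "\<And>y. y \<in> Y \<Longrightarrow> card {j \<in> J. hit j y} \<le> 2"
proof -
  define P where "P a b c \<longleftrightarrow> (\<forall>y\<in>Y. \<not> (hit a y \<and> hit b y \<and> hit c y))" for a b c
  have ev: "\<forall>\<^sub>F b in sequentially. \<forall>\<^sub>F c in sequentially. P a b c" for a
    unfolding P_def by (rule assms(2))
  have "\<exists>J\<subseteq>A. finite J \<and> card J = m \<and> (\<forall>a\<in>J. \<forall>b\<in>J. a < b \<longrightarrow> eventually (P a b) sequentially) \<and>
      (\<forall>a\<in>J. \<forall>b\<in>J. \<forall>c\<in>J. a < b \<longrightarrow> b < c \<longrightarrow> P a b c)"
  proof (induction m)
    case 0
    show ?case by (intro exI[of _ "{}"]) simp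
  next
    case (Suc m)
    then obtain J where J: "J \<subseteq> A" "finite J" "card J = m"
      and pairs: "\<forall>a\<in>J. \<forall>b\<in>J. a < b \<longrightarrow> eventually (P a b) sequentially"
      and triples: "\<forall>a\<in>J. \<forall>b\<in>J. \<forall>c\<in>J. a < b \<longrightarrow> b < c \<longrightarrow> P a b c" by blast
    have "\<forall>\<^sub>F n in sequentially. a < n \<and> eventually (P a n) sequentially \<and> (\<forall>b\<in>J. a < b \<longrightarrow> P a b n)"
      if "a \<in> J" for a
    proof (intro eventually_conj eventually_gt_at_top ev eventually_ball_finite[OF J(2)] ballI)
      fix b assume "b \<in> J"
      then show "\<forall>\<^sub>F n in sequentially. a < b \<longrightarrow> P a b n"
        using pairs \<open>a \<in> J\<close> by (cases "a < b") auto
    qed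
    then have "\<forall>\<^sub>F n in sequentially. \<forall>a\<in>J. a < n \<and> eventually (P a n) sequentially \<and> (\<forall>b\<in>J. a < b \<longrightarrow> P a b n)"
      using J(2) by (intro eventually_ball_finite) auto
    then obtain N where N: "\<And>n. N \<le> n \<Longrightarrow>
        \<forall>a\<in>J. a < n \<and> eventually (P a n) sequentially \<and> (\<forall>b\<in>J. a < b \<longrightarrow> P a b n)"
      by (auto simp: eventually_sequentially)
    obtain n where n: "N < n" "n \<in> A" using inf by (auto simp: infinite_nat_iff_unbounded)
    then have new: "\<And>a. a \<in> J \<Longrightarrow> a < n" "\<And>a. a \<in> J \<Longrightarrow> eventually (P a n) sequentially"
      "\<And>a b. a \<in> J \<Longrightarrow> b \<in> J \<Longrightarrow> a < b \<Longrightarrow> P a b n" using N[of n] by auto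
    have "n \<notin> J" using new(1) by blast
    moreover have "\<forall>a\<in>insert n J. \<forall>b\<in>insert n J. a < b \<longrightarrow> eventually (P a b) sequentially"
    proof (intro ballI impI)
      fix a b assume ab: "a \<in> insert n J" "b \<in> insert n J" "a < b"
      then have "a \<in> J" using new(1)[of b] by auto
      then show "eventually (P a b) sequentially"
        using ab pairs new(2) by (cases "b = n") auto
    qed
    moreover have "\<forall>a\<in>insert n J. \<forall>b\<in>insert n J. \<forall>c\<in>insert n J. a < b \<longrightarrow> b < c \<longrightarrow> P a b c"
    proof (intro ballI impI)
      fix a b c assume abc: "a \<in> insert n J" "b \<in> insert n J" "c \<in> insert n J" "a < b" "b < c"
      then have "b \<in> J" using new(1)[of c] by auto
      moreover from this have "a \<in> J" using abc new(1)[of b] by auto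
      ultimately show "P a b c"
        using abc triples new(3) by (cases "c = n") auto
    qed
    ultimately show ?case
      using J n(2) by (intro exI[of _ "insert n J"]) auto
  qed
  then obtain J where J: "J \<subseteq> A" "finite J" "card J = m"
    and triples: "\<forall>a\<in>J. \<forall>b\<in>J. \<forall>c\<in>J. a < b \<longrightarrow> b < c \<longrightarrow> P a b c" by auto
  have "card {j \<in> J. hit j y} \<le> 2" if "y \<in> Y" for y
  proof -
    let ?S = "{j \<in> J. hit j y}"
    have fin: "finite ?S" using J by simp
    have "?S \<subseteq> {Min ?S, Max ?S}"
    proof
      \<comment> \<open>A third hit strictly between the least and the greatest one would be a
        forbidden triple.\<close>
      fix j assume j: "j \<in> ?S"
      then have ne: "?S \<noteq> {}" by blast
      have in_S: "Min ?S \<in> ?S" "Max ?S \<in> ?S" using Min_in[OF fin ne] Max_in[OF fin ne] by auto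
      have "\<not> (Min ?S < j \<and> j < Max ?S)"
        using triples[rule_format, of "Min ?S" j "Max ?S"] in_S j that unfolding P_def by blast
      moreover have "Min ?S \<le> j" "j \<le> Max ?S" using fin j by auto
      ultimately show "j \<in> {Min ?S, Max ?S}" by auto
    qed
    then have "card ?S \<le> card {Min ?S, Max ?S}" by (intro card_mono) auto
    also have "\<dots> \<le> 2" by (simp add: card_insert_if)
    finally show ?thesis .
  qed
  with J that show thesis by blast
qed

section \<open>A criterion for weak convergence to zero\<close>

lemma C0_apply_sum: "C0_apply (sum g J) x = (\<Sum>j\<in>J. C0_apply (g j) x)"
  by (induction J rule: infinite_finite_induct) auto

text \<open>Replaces the Riesz representation theorem and dominated convergence: if \<open>\<bar>L (g j)\<bar> \<ge> r\<close> for all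
  \<open>j\<close> in a finite set \<open>J\<close>, rotate each \<open>g j\<close> by a phase so that \<open>L\<close> is at least \<open>r * card J\<close> on the sum.
  Every point sees at most two large summands, so the norm of the sum is at most
  \<open>2 * C + \<delta> * card J\<close>, which is too small once \<open>card J\<close> is large.\<close>

lemma weakly_tendsto_0_if_few_hits:
  fixes g :: "nat \<Rightarrow> C0"
  assumes bound: "\<And>n. norm (g n) \<le> C"
    and few: "\<And>\<delta> A m. 0 < \<delta> \<Longrightarrow> infinite A \<Longrightarrow>
      \<exists>J\<subseteq>A. finite J \<and> card J = m \<and> (\<forall>y. card {j \<in> J. \<delta> \<le> cmod (C0_apply (g j) y)} \<le> 2)"
  shows "weakly_tendsto g 0"
  unfolding weakly_tendsto_def
proof (intro allI impI)
  fix L :: "C0 \<Rightarrow> complex" assume L: "bounded_clinear L"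
  then have lin: "bounded_linear L" and scale: "\<And>c x. L (c *\<^sub>C x) = c * L x"
    by (auto simp: bounded_clinear_def scaleC_complex_def)
  interpret L: bounded_linear L by (rule lin)
  obtain B where B: "0 < B" "\<And>x. cmod (L x) \<le> norm x * B" using L.pos_bounded by blast
  have C: "0 \<le> C" using bound[of 0] norm_ge_zero order_trans by blast
  have "(\<lambda>n. L (g n)) \<longlonglongrightarrow> 0"
  proof (rule ccontr)
    assume "\<not> ?thesis"
    then obtain r where r: "0 < r" and freq: "\<And>N. \<exists>n\<ge>N. r \<le> cmod (L (g n))"
      by (auto simp: LIMSEQ_iff not_less)
    define A where "A = {n. r \<le> cmod (L (g n))}"
    have "infinite A" using freq by (auto simp: A_def infinite_nat_iff_unbounded_le)
    \<comment> \<open>With this \<open>\<delta>\<close> the small summands contribute at most half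
      of r * card J to the estimate of L; the bound on \<open>m\<close> then makes the other half
      exceed 2 B C.\<close>
    define \<delta> where "\<delta> = r / (2 * B)"
    have \<delta>: "0 < \<delta>" using r B by (simp add: \<delta>_def)
    obtain m :: nat where m: "4 * B * C / r < real m" using reals_Archimedean2 by blast
    obtain J where J: "J \<subseteq> A" "finite J" "card J = m"
      and hits: "\<And>y. card {j \<in> J. \<delta> \<le> cmod (C0_apply (g j) y)} \<le> 2"
      using few[OF \<delta> \<open>infinite A\<close>, of m] by blast
    define x where "x = (\<Sum>j\<in>J. cnj (sgn (L (g j))) *\<^sub>C g j)"
    have cnj_sgn: "cnj (sgn z) * z = complex_of_real (cmod z)" for z
      by (cases "z = 0") (simp_all add: sgn_div_norm complex_norm_square[symmetric] mult.commute
        scaleR_conv_of_real power2_eq_square divide_simps)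
    have "L x = complex_of_real (\<Sum>j\<in>J. cmod (L (g j)))"
      by (simp add: x_def L.sum scale cnj_sgn)
    then have "cmod (L x) = (\<Sum>j\<in>J. cmod (L (g j)))"
      by (simp add: sum_nonneg del: of_real_sum)
    moreover have "(\<Sum>j\<in>J. r) \<le> (\<Sum>j\<in>J. cmod (L (g j)))"
      using J(1) by (intro sum_mono) (auto simp: A_def)
    ultimately have "real m * r \<le> cmod (L x)" using J(3) by simp
    moreover have "norm x \<le> 2 * C + real m * \<delta>"
    proof (rule C0_norm_leI)
      fix y
      have "cmod (C0_apply x y) \<le> (\<Sum>j\<in>J. cmod (C0_apply (cnj (sgn (L (g j))) *\<^sub>C g j) y))"
        unfolding x_def C0_apply_sum by (rule norm_sum)
      also have "\<dots> \<le> (\<Sum>j\<in>J. (if \<delta> \<le> cmod (C0_apply (g j) y) then C else 0) + \<delta>)"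
      proof (rule sum_mono)
        fix j
        have "cmod (sgn (L (g j))) \<le> 1" by (simp add: norm_sgn)
        then have "cmod (C0_apply (cnj (sgn (L (g j))) *\<^sub>C g j) y) \<le> cmod (C0_apply (g j) y)"
          by (simp add: norm_mult mult_left_le_one_le)
        moreover have "cmod (C0_apply (g j) y) \<le> C" using C0_apply_le_norm bound order_trans by blast
        ultimately show "cmod (C0_apply (cnj (sgn (L (g j))) *\<^sub>C g j) y)
            \<le> (if \<delta> \<le> cmod (C0_apply (g j) y) then C else 0) + \<delta>"
          using \<delta> by auto
      qed
      also have "\<dots> = C * real (card {j \<in> J. \<delta> \<le> cmod (C0_apply (g j) y)}) + real m * \<delta>"
        using J by (simp add: sum.distrib sum.If_cases Int_def)
      also have "\<dots> \<le> C * 2 + real m * \<delta>"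
        using hits[of y] C by (intro add_right_mono mult_left_mono) auto
      finally show "cmod (C0_apply x y) \<le> 2 * C + real m * \<delta>" by simp
    qed
    then have "norm x * B \<le> (2 * C + real m * \<delta>) * B" using B(1) by simp
    ultimately have "real m * r \<le> (2 * C + real m * \<delta>) * B" using B(2)[of x] by linarith
    moreover have "\<delta> * B = r / 2" using B(1) by (simp add: \<delta>_def)
    then have "(2 * C + real m * \<delta>) * B = 2 * C * B + real m * (r / 2)" by (simp add: algebra_simps)
    moreover have "real m * (r / 2) = real m * r / 2" "2 * C * B = 2 * (B * C)" by simp_all
    ultimately have "real m * r \<le> 4 * (B * C)" by linarith
    then have "real m * r \<le> 4 * B * C" by simp
    then show False using m r by (simp add: field_simps)
  qed
  then show "(\<lambda>n. L (g n)) \<longlonglongrightarrow> L 0" by (simp add: L.zero)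
qed

section \<open>The operator\<close>

text \<open>This is where the argument of \<open>Abs_C0\<close> is shown to lie in the space. For
  vanishing at infinity, the compact set of \<open>f\<close> is carried back by the homeomorphism
  \<open>flow (- t)\<close>.\<close>

lemma C0_apply_T0: "C0_apply (T0 t f) x = (if x \<in> phase_space then C0_apply f (flow t x) else 0)"
proof -
  let ?g = "\<lambda>x. if x \<in> phase_space then C0_apply f (flow t x) else 0"
  have flow_minus_1: "flow s ` (phase_space - {1}) \<subseteq> phase_space - {1}" for s
    using flow_in_phase_space flow_eq_1_iff by auto
  have "continuous_on (phase_space - {1}) (\<lambda>x. C0_apply f (flow t x))"
    by (rule continuous_on_compose2[OF C0_continuous_on _ flow_minus_1])
      (rule continuous_on_subset[OF continuous_on_flow_time], blast)
  then have "continuous_on (phase_space - {1}) ?g"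
    by (subst continuous_on_cong[OF refl, where g = "\<lambda>x. C0_apply f (flow t x)"]) auto
  moreover have "vanishes_at_infinity_on (phase_space - {1}) ?g"
    unfolding vanishes_at_infinity_on_def
  proof (intro allI impI)
    fix e :: real assume "0 < e"
    then obtain K where K: "compact K" "K \<subseteq> phase_space - {1}"
        "\<forall>x\<in>(phase_space - {1}) - K. cmod (C0_apply f x) < e"
      using C0_vanishes[of f] unfolding vanishes_at_infinity_on_def by meson
    have "compact (flow (- t) ` K)"
      using K continuous_on_subset[OF continuous_on_flow_time, of K] by (intro compact_continuous_image) auto
    moreover have "flow (- t) ` K \<subseteq> phase_space - {1}" using K(2) flow_minus_1 by blast
    moreover have "cmod (?g x) < e" if x: "x \<in> (phase_space - {1}) - flow (- t) ` K" for x
    proof -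
      have "flow (- t) (flow t x) = x" using x by (simp add: flow_add flow_0)
      then have "flow t x \<notin> K" using x by (metis DiffD2 image_eqI)
      then show ?thesis using K(3) flow_minus_1[of t] x by auto
    qed
    ultimately show "\<exists>K. compact K \<and> K \<subseteq> phase_space - {1} \<and>
        (\<forall>x\<in>(phase_space - {1}) - K. cmod (?g x) < e)" by blast
  qed
  moreover have "?g x = 0" if "x \<notin> phase_space - {1}" for x
    using that by (auto simp: flow_1 C0_apply_outside)
  ultimately have "C0_apply (Abs_C0 ?g) = ?g" by (intro Abs_C0_inverse) auto
  then show ?thesis by (simp add: T0_def)
qed

lemma norm_T0_le: "norm (T0 t f) \<le> norm f"
  using C0_apply_le_norm by (intro C0_norm_leI) (auto simp: C0_apply_T0)

lemma bounded_clinear_T0: "bounded_clinear (T0 t)"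
  unfolding bounded_clinear_def
proof (intro conjI allI)
  show "bounded_linear (T0 t)"
    by (rule bounded_linear_intro[where K = 1])
      (auto intro!: C0_eqI simp: C0_apply_T0 norm_T0_le)
qed (auto intro!: C0_eqI simp: C0_apply_T0)

lemma C0_apply_T0_funpow:
  "C0_apply ((T0 1 ^^ n) f) x = (if x \<in> phase_space then C0_apply f (flow (real n) x) else 0)"
  by (induction n arbitrary: x)
    (simp_all add: C0_apply_T0 flow_0 flow_add flow_in_phase_space C0_apply_outside)

lemma norm_T0_funpow_le: "norm ((T0 1 ^^ n) f) \<le> norm f"
  using C0_apply_le_norm by (intro C0_norm_leI) (auto simp: C0_apply_T0_funpow)

section \<open>Decay along orbits and absence of unimodular eigenvalues\<close>

lemma C0_vanishes_along:
  assumes "\<And>n. x n \<in> phase_space - {1}"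
    and "\<And>K. compact K \<Longrightarrow> K \<subseteq> phase_space - {1} \<Longrightarrow> \<forall>\<^sub>F n in F. x n \<notin> K"
  shows "((\<lambda>n. C0_apply f (x n)) \<longlongrightarrow> 0) F"
proof (rule tendstoI)
  fix e :: real assume "0 < e"
  then obtain K where K: "compact K" "K \<subseteq> phase_space - {1}"
      "\<forall>x\<in>(phase_space - {1}) - K. cmod (C0_apply f x) < e"
    using C0_vanishes[of f] unfolding vanishes_at_infinity_on_def by meson
  show "\<forall>\<^sub>F n in F. dist (C0_apply f (x n)) 0 < e"
    using assms(2)[OF K(1,2)] by eventually_elim (use assms(1) K(3) in auto)
qed

lemma C0_apply_homoclinic_tendsto_0: "(\<lambda>n. C0_apply f (homoclinic (s + real n))) \<longlonglongrightarrow> 0"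
proof (rule C0_vanishes_along)
  show "homoclinic (s + real n) \<in> phase_space - {1}" for n
    by (simp add: homoclinic_in_phase_space homoclinic_neq_1)
  fix K assume K: "compact K" "K \<subseteq> phase_space - {1}"
  obtain R where R: "\<And>t. homoclinic t \<in> K \<Longrightarrow> \<bar>t\<bar> \<le> R" using compact_return_times[OF K] by metis
  have "\<forall>\<^sub>F n in sequentially. R - s < real n" by real_asymp
  then show "\<forall>\<^sub>F n in sequentially. homoclinic (s + real n) \<notin> K"
    by eventually_elim (use R in fastforce)
qed

text \<open>Time runs backwards here, since forwards the curve keeps returning near -1. Backwards it
  tends to 0, which is outside the phase space.\<close>

lemma C0_apply_curve_tendsto_0: "(\<lambda>n. C0_apply f (curve (s - real n))) \<longlonglongrightarrow> 0"
proof (rule C0_vanishes_along)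
  show "curve (s - real n) \<in> phase_space - {1}" for n
    by (simp add: curve_in_phase_space curve_neq_1)
  fix K assume K: "compact K" "K \<subseteq> phase_space - {1}"
  obtain R where R: "\<And>t. curve t \<in> K \<Longrightarrow> \<exists>k::nat. \<bar>t - (2 * real k ^ 2 + 1)\<bar> \<le> R"
    using compact_return_times[OF K] by metis
  have "\<forall>\<^sub>F n in sequentially. s + R < real n" by real_asymp
  then show "\<forall>\<^sub>F n in sequentially. curve (s - real n) \<notin> K"
  proof eventually_elim
    case (elim n)
    have "\<not> \<bar>s - real n - (2 * real k ^ 2 + 1)\<bar> \<le> R" for k :: nat
      using elim zero_le_power2[of "real k"] by linarith
    then show ?case using R by blast
  qed
qed

text \<open>The modulus of such an eigenfunction is constant along integer steps of the flow, while
  it tends to 0 forwards on the homoclinic orbit and backwards on the curve.\<close>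

lemma no_unimodular_eigenvalue:
  assumes z: "cmod z = 1"
  shows "\<not> eigenvalue (T0 1) z"
proof
  assume "eigenvalue (T0 1) z"
  then obtain f where f: "f \<noteq> 0" "T0 1 f = z *\<^sub>C f" by (auto simp: eigenvalue_def)
  have step: "cmod (C0_apply f (flow 1 x)) = cmod (C0_apply f x)" if "x \<in> phase_space" for x
    using arg_cong[OF f(2), of "\<lambda>g. cmod (C0_apply g x)"] z that by (simp add: C0_apply_T0 norm_mult)
  have iterate: "cmod (C0_apply f (flow (real n) x)) = cmod (C0_apply f x)" if "x \<in> phase_space" for n x
  proof (induction n)
    case (Suc n)
    have "flow (real (Suc n)) x = flow 1 (flow (real n) x)" using that by (simp add: flow_add add.commute)
    then show ?case using Suc step[OF flow_in_phase_space[OF that]] by simp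
  qed (simp add: flow_0 that)
  have "C0_apply f x = 0" if x: "x \<in> phase_space" for x
    using x
  proof (cases rule: phase_space_cases)
    case fixed
    then show ?thesis by (simp add: C0_apply_outside)
  next
    case (circle s)
    have "cmod (C0_apply f (homoclinic (s + real n))) = cmod (C0_apply f x)" for n
      using iterate[OF x, of n] by (simp add: circle flow_homoclinic)
    then have "(\<lambda>n::nat. cmod (C0_apply f x)) \<longlonglongrightarrow> 0"
      using tendsto_norm[OF C0_apply_homoclinic_tendsto_0[of f s]] by simp
    then show ?thesis by (simp add: LIMSEQ_const_iff)
  next
    case (curve s)
    have "cmod (C0_apply f (curve (s - real n))) = cmod (C0_apply f x)" for n
      using iterate[OF curve_in_phase_space, of n "s - real n"] by (simp add: curve flow_curve)
    then have "(\<lambda>n::nat. cmod (C0_apply f x)) \<longlonglongrightarrow> 0"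
      using tendsto_norm[OF C0_apply_curve_tendsto_0[of f s]] by simp
    then show ?thesis by (simp add: LIMSEQ_const_iff)
  qed
  then have "f = 0" by (intro C0_eqI) (metis C0_apply_outside C0_apply_zero DiffD1)
  with f(1) show False by simp
qed

text \<open>Two visits of \<open>curve s\<close> to \<open>K\<close>, at times \<open>\<nu> a\<close> and \<open>\<nu> b\<close>, are close to \<open>2 * i\<^sup>2 + 1\<close> and
  \<open>2 * j\<^sup>2 + 1\<close> with \<open>i < j\<close>. Since \<open>j\<^sup>2 - i\<^sup>2 > 2 * i\<close>, the time between the visits bounds \<open>i\<close> and hence
  \<open>s\<close>, so \<open>s + \<nu> c\<close> is as far from the return times as the far time \<open>\<nu> c\<close>, up to a constant.\<close>

lemma eventually_no_triple_return:
  fixes \<nu> :: "nat \<Rightarrow> nat"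
  assumes K: "compact K" "K \<subseteq> phase_space - {1}" and \<nu>: "strict_mono \<nu>" "range \<nu> \<subseteq> far_times"
  shows "\<forall>\<^sub>F b in sequentially. \<forall>\<^sub>F c in sequentially. \<forall>y\<in>phase_space.
    \<not> (flow (real (\<nu> a)) y \<in> K \<and> flow (real (\<nu> b)) y \<in> K \<and> flow (real (\<nu> c)) y \<in> K)"
proof -
  obtain R where R: "0 < R" "\<And>t. curve t \<in> K \<Longrightarrow> \<exists>k::nat. \<bar>t - (2 * real k ^ 2 + 1)\<bar> \<le> R"
    "\<And>t. homoclinic t \<in> K \<Longrightarrow> \<bar>t\<bar> \<le> R"
    using compact_return_times[OF K] by metis
  have \<nu>_ge: "real n \<le> real (\<nu> n)" for n using strict_mono_imp_increasing[OF \<nu>(1)] by simp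
  \<comment> \<open>A time gap above 2 R rules out two visits on the homoclinic orbit and forces
    distinct return times i < j on the curve.\<close>
  have "\<forall>\<^sub>F b in sequentially. real (\<nu> a) + 2 * R < real b" by real_asymp
  then show ?thesis
  proof eventually_elim
    case (elim b)
    define d where "d = real (\<nu> b) - real (\<nu> a)"
    have d: "2 * R < d" using elim \<nu>_ge[of b] by (simp add: d_def)
    define U where "U = 2 * (d + 2 * R) ^ 2 + 1"
    \<comment> \<open>Since s + nu(a) is within \<open>R\<close> of 2 i^2 + 1 <= U, |s| is at most U
      + R + nu(a); the second \<open>R\<close> comes from the visit at nu(c).\<close>
    obtain M where M: "\<And>n k :: nat. n \<in> far_times \<Longrightarrow> M \<le> n \<Longrightarrow>
        U + 2 * R + real (\<nu> a) < \<bar>real n - (2 * real k ^ 2 + 1)\<bar>"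
      using far_times_eventually_far by blast
    show "\<forall>\<^sub>F c in sequentially. \<forall>y\<in>phase_space.
      \<not> (flow (real (\<nu> a)) y \<in> K \<and> flow (real (\<nu> b)) y \<in> K \<and> flow (real (\<nu> c)) y \<in> K)"
    proof (rule eventually_sequentiallyI[of M], intro ballI notI, elim conjE)
      fix c y assume c: "M \<le> c" and y: "y \<in> phase_space"
        and hits: "flow (real (\<nu> a)) y \<in> K" "flow (real (\<nu> b)) y \<in> K" "flow (real (\<nu> c)) y \<in> K"
      from y show False
      proof (cases rule: phase_space_cases)
        case fixed
        then show False using hits(1) K(2) by (auto simp: flow_1)
      next
        case (circle s)
        then have "\<bar>s + real (\<nu> a)\<bar> \<le> R" "\<bar>s + real (\<nu> b)\<bar> \<le> R"
          using hits R(3) by (simp_all add: flow_homoclinic)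
        then show False using d unfolding d_def by linarith
      next
        case (curve s)
        note hits = hits[unfolded curve flow_curve, THEN R(2)]
        obtain i :: nat where i: "\<bar>s + real (\<nu> a) - (2 * real i ^ 2 + 1)\<bar> \<le> R"
          using hits(1) ..
        obtain j :: nat where j: "\<bar>s + real (\<nu> b) - (2 * real j ^ 2 + 1)\<bar> \<le> R"
          using hits(2) ..
        obtain k :: nat where k: "\<bar>s + real (\<nu> c) - (2 * real k ^ 2 + 1)\<bar> \<le> R"
          using hits(3) ..
        have diff: "2 * real j ^ 2 - 2 * real i ^ 2 \<le> d + 2 * R" "0 < 2 * real j ^ 2 - 2 * real i ^ 2"
          using i j d unfolding d_def by linarith+
        then have "real i ^ 2 < real j ^ 2" by simp
        then have "i < j" using power_less_imp_less_base[of "real i" 2 "real j"] by simp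
        then have "(real i + 1) ^ 2 \<le> real j ^ 2" by (intro power_mono) auto
        then have "real i ^ 2 + 2 * real i + 1 \<le> real j ^ 2" by (simp add: power2_sum)
        then have "real i \<le> d + 2 * R" using diff(1) by linarith
        then have "real i ^ 2 \<le> (d + 2 * R) ^ 2" by (intro power_mono) auto
        then have "2 * real i ^ 2 + 1 \<le> U" by (simp add: U_def)
        moreover have "\<nu> c \<in> far_times" "M \<le> \<nu> c"
          using \<nu> c \<nu>_ge[of c] by auto
        then have "U + 2 * R + real (\<nu> a) < \<bar>real (\<nu> c) - (2 * real k ^ 2 + 1)\<bar>" by (rule M)
        moreover have "0 \<le> real i ^ 2" by simp
        ultimately show False using i k by linarith
      qed
    qed
  qed
qed

text \<open>A power of the operator applied to \<open>f\<close> has modulus at least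
  \<open>\<delta>\<close> at \<open>y\<close> only when the orbit of \<open>y\<close> is in the
  compact set outside which |f| < \<open>\<delta>\<close>, so triple visits control triple
  hits.\<close>

lemma weakly_null_along_far_times:
  fixes \<nu> :: "nat \<Rightarrow> nat"
  assumes \<nu>: "strict_mono \<nu>" "range \<nu> \<subseteq> far_times"
  shows "weakly_tendsto (\<lambda>k. (T0 1 ^^ \<nu> k) f) 0"
proof (rule weakly_tendsto_0_if_few_hits[OF norm_T0_funpow_le])
  fix \<delta> :: real and A :: "nat set" and m :: nat
  assume "0 < \<delta>" and A: "infinite A"
  then obtain K where K: "compact K" "K \<subseteq> phase_space - {1}"
      "\<forall>x\<in>(phase_space - {1}) - K. cmod (C0_apply f x) < \<delta>"
    using C0_vanishes[of f] unfolding vanishes_at_infinity_on_def by meson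
  obtain J where J: "J \<subseteq> A" "finite J" "card J = m"
    and hits: "\<And>y. y \<in> phase_space \<Longrightarrow> card {j \<in> J. flow (real (\<nu> j)) y \<in> K} \<le> 2"
    using finite_subset_at_most_two_hits[OF A eventually_no_triple_return[OF K(1,2) \<nu>]] by blast
  have "card {j \<in> J. \<delta> \<le> cmod (C0_apply ((T0 1 ^^ \<nu> j) f) y)} \<le> 2" for y
  proof (cases "y \<in> phase_space")
    case True
    have "x \<in> K" if "\<delta> \<le> cmod (C0_apply f x)" for x
      using that \<open>0 < \<delta>\<close> K(3) C0_apply_outside[of x f] by (cases "x \<in> phase_space - {1}") force+
    then have "{j \<in> J. \<delta> \<le> cmod (C0_apply ((T0 1 ^^ \<nu> j) f) y)} \<subseteq> {j \<in> J. flow (real (\<nu> j)) y \<in> K}"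
      using True by (auto simp: C0_apply_T0_funpow)
    then have "card {j \<in> J. \<delta> \<le> cmod (C0_apply ((T0 1 ^^ \<nu> j) f) y)}
        \<le> card {j \<in> J. flow (real (\<nu> j)) y \<in> K}"
      using J(2) by (intro card_mono) auto
    then show ?thesis using hits[OF True] by linarith
  next
    case False
    then show ?thesis using \<open>0 < \<delta>\<close> by (simp add: C0_apply_T0_funpow)
  qed
  with J show "\<exists>J\<subseteq>A. finite J \<and> card J = m \<and>
      (\<forall>y. card {j \<in> J. \<delta> \<le> cmod (C0_apply ((T0 1 ^^ \<nu> j) f) y)} \<le> 2)" by blast
qed

lemma almost_weakly_stable_T0: "almost_weakly_stable (T0 1)"
  unfolding almost_weakly_stable_def almost_weakly_stable_seq_def
proof (intro allI exI[of _ "enumerate far_times"] conjI)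
  note inf = enumerate_has_density_1(1)[OF far_times_density]
  show mono: "strict_mono (enumerate far_times)"
    using inf by (simp add: strict_mono_def enumerate_mono)
  have ran: "range (enumerate far_times) \<subseteq> far_times" using range_enumerate[OF inf] by simp
  then show "1 \<le> enumerate far_times k" for k
    using enumerate_in_set[OF inf, of k] by (simp add: far_times_def)
  show "has_density (enumerate far_times) 1"
    by (rule enumerate_has_density_1(2)[OF far_times_density])
  show "weakly_tendsto (\<lambda>k. (T0 1 ^^ enumerate far_times k) f) 0" for f
    by (rule weakly_null_along_far_times[OF mono ran])
qed

section \<open>Returns along the polynomial\<close>

text \<open>The forward end of the curve accumulates only on the circle. The set is therefore an
  intersection of closed sets, each a compact arc together with a closed annulus shrinking to the
  circle.\<close>

lemma closed_circle_Un_curve: "closed (sphere 0 1 \<union> curve ` {c..})"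
proof -
  have "sphere 0 1 \<union> curve ` {c..} = (\<Inter>n::nat. curve ` {c..real n} \<union> {z. radius (real n) \<le> cmod z \<and> cmod z \<le> 1})"
    (is "?A = ?B")
  proof
    show "?A \<subseteq> ?B"
    proof (intro INT_greatest subsetI)
      fix n :: nat and z assume "z \<in> ?A"
      then consider "cmod z = 1" | t where "z = curve t" "c \<le> t" by auto
      then show "z \<in> curve ` {c..real n} \<union> {z. radius (real n) \<le> cmod z \<and> cmod z \<le> 1}"
      proof cases
        case (2 t)
        then show ?thesis
          using radius_strict_mono[of n t] radius_less_1[of t] by (cases "t \<le> n") (auto simp: norm_curve)
      qed (simp add: less_imp_le[OF radius_less_1])
    qed
    show "?B \<subseteq> ?A"
    proof
      fix z assume "z \<in> ?B"
      then have z: "z \<in> curve ` {c..real n} \<union> {z. radius (real n) \<le> cmod z \<and> cmod z \<le> 1}" for n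
        by (rule INT_D) simp
      show "z \<in> ?A"
      proof (cases "cmod z < 1")
        case True
        \<comment> \<open>This makes \<open>radius (real n)\<close> exceed |z|, so \<open>z\<close>
          is not in the annulus and lies on the arc.\<close>
        obtain n :: nat where n: "1 / (1 - cmod z) < real n" using reals_Archimedean2 by blast
        have pos: "0 < 1 / (1 - cmod z)" using True by simp
        then have "1 \<le> real n" using n by (cases n) auto
        moreover have "1 < real n * (1 - cmod z)" using n True by (simp add: field_simps)
        then have "cmod z < 1 - 1 / (2 * real n)" using \<open>1 \<le> real n\<close> True by (simp add: field_simps)
        ultimately have "cmod z < radius (real n)" by (simp add: radius_def)
        then show ?thesis using z[of n] by auto
      next
        case False
        moreover have "cmod z \<le> 1" using z[of 0] by (auto simp: norm_curve less_imp_le[OF radius_less_1])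
        ultimately show ?thesis by simp
      qed
    qed
  qed
  moreover have "closed (curve ` {c..real n} \<union> {z. radius (real n) \<le> cmod z \<and> cmod z \<le> 1})" for n
    using continuous_on_subset[OF continuous_on_curve]
    by (intro closed_Un compact_imp_closed compact_continuous_image closed_Collect_conj closed_Collect_le
      continuous_intros) auto
  ultimately show ?thesis by (simp only:) (intro closed_INT ballI)
qed

text \<open>The witness is z (z - 1), with value 2 at -1: one factor gives decay at the backward end
  0 of the curve, the other at the removed point 1. Without such a function the limits f(-1) would
  not contradict weak convergence to zero.\<close>

lemma C0_nonzero_at_minus_1: "\<exists>f. C0_apply f (-1) \<noteq> 0"
proof -
  define g :: "complex \<Rightarrow> complex" where "g z = (if z \<in> phase_space - {1} then z * (z - 1) else 0)" for z
  have "continuous_on (phase_space - {1}) (\<lambda>z. z * (z - 1))" by (intro continuous_intros)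
  then have "continuous_on (phase_space - {1}) g"
    by (subst continuous_on_cong[OF refl, where g = "\<lambda>z. z * (z - 1)"]) (auto simp: g_def)
  moreover have "vanishes_at_infinity_on (phase_space - {1}) g"
    unfolding vanishes_at_infinity_on_def
  proof (intro allI impI)
    fix e :: real assume e: "0 < e"
    \<comment> \<open>For t < c the exponential formula for the radius applies and gives |z| < e /
      2, which suffices because |z - 1| <= 2.\<close>
    define c where "c = min 0 (ln (e / 2))"
    define K where "K = (sphere 0 1 \<union> curve ` {c..}) \<inter> {z. e / 2 \<le> cmod (z - 1)}"
    have "closed K"
      unfolding K_def by (intro closed_Int closed_circle_Un_curve closed_Collect_le continuous_intros)
    moreover have "K \<subseteq> cball 0 1"
      by (auto simp: K_def norm_curve less_imp_le[OF radius_less_1])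
    ultimately have "compact K" by (metis bounded_cball bounded_subset compact_eq_bounded_closed)
    moreover have "K \<subseteq> phase_space - {1}" using e by (auto simp: K_def phase_space_def)
    moreover have "cmod (g z) < e" if z: "z \<in> (phase_space - {1}) - K" for z
    proof -
      have le1: "cmod z \<le> 1" using z by (auto simp: phase_space_def norm_curve less_imp_le[OF radius_less_1])
      have gz: "cmod (g z) = cmod z * cmod (z - 1)" using z by (simp add: g_def norm_mult)
      show ?thesis
      proof (cases "cmod (z - 1) < e / 2")
        case True
        have "cmod z * cmod (z - 1) \<le> cmod (z - 1)" using le1 by (simp add: mult_left_le_one_le)
        then show ?thesis using gz True e by linarith
      next
        case False
        then have "z \<notin> sphere 0 1 \<union> curve ` {c..}" using z by (simp add: K_def)
        moreover from this obtain t where "z = curve t" using z by (auto simp: phase_space_def)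
        ultimately have t: "z = curve t" "t < c" by (auto simp: not_le[symmetric])
        then have "radius t = exp (t - 1) / 2" "t - 1 < ln (e / 2)" by (auto simp: radius_def c_def)
        moreover from this have "exp (t - 1) < e / 2" using e exp_less_mono[of "t - 1" "ln (e / 2)"] by simp
        ultimately have "cmod z < e / 2" using t(1) e by (simp add: norm_curve)
        moreover have "cmod (z - 1) \<le> 2" using norm_triangle_ineq4[of z 1] le1 by simp
        then have "cmod z * cmod (z - 1) \<le> cmod z * 2" by (intro mult_left_mono) auto
        ultimately show ?thesis using gz by linarith
      qed
    qed
    ultimately show "\<exists>K. compact K \<and> K \<subseteq> phase_space - {1} \<and>
        (\<forall>z\<in>(phase_space - {1}) - K. cmod (g z) < e)" by blast
  qed
  ultimately have "C0_apply (Abs_C0 g) = g" by (intro Abs_C0_inverse) (auto simp: g_def)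
  moreover have "g (-1) \<noteq> 0" by (simp add: g_def phase_space_def)
  ultimately show ?thesis by metis
qed

text \<open>With n = k + 1 the time is 2 k^2 + 1, the start of the departing piece of block
  \<open>k\<close>. The cases n = 1 and n = 2 give the times 1 and 3 on the initial piece.\<close>

lemma omega_at_return:
  fixes n :: nat
  assumes "1 \<le> n"
  shows "omega (2 * real n ^ 2 - 4 * real n + 3) = - (2 * real n - 1) * pi"
proof -
  consider "n = 1" | "n = 2" | "3 \<le> n" using assms by linarith
  then show ?thesis
  proof cases
    case 3
    define k where "k = n - 1"
    have k: "2 \<le> k" and n: "real n = real k + 1" using 3 by (auto simp: k_def)
    have t: "2 * real n ^ 2 - 4 * real n + 3 = 2 * real k ^ 2 + 1"
      by (simp add: n power2_eq_square algebra_simps)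
    have "omega (2 * real k ^ 2 + 1) = - (2 * real k + 2) * pi + pi / 1"
      using omega_depart[OF k, of "2 * real k ^ 2 + 1"] by simp
    then show ?thesis by (simp add: t) (simp add: n algebra_simps)
  qed (simp_all add: omega_le_3)
qed

lemma curve_at_return_tendsto: "(\<lambda>n::nat. curve (2 * real n ^ 2 - 4 * real n + 3)) \<longlonglongrightarrow> -1"
proof -
  have "cis (- (2 * real n - 1) * pi) = -1" for n
  proof -
    have "- (2 * real n - 1) * pi = pi + 2 * pi * (- real n)" by (simp add: algebra_simps)
    then show ?thesis using cis_multiple_2pi[of "- real n"] by (simp only: cis_mult[symmetric]) simp
  qed
  moreover have "1 \<le> 2 * real n ^ 2 - 4 * real n + 3" for n
    using zero_le_power2[of "real n - 1"] by (simp add: power2_diff)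
  ultimately have "curve (2 * real n ^ 2 - 4 * real n + 3)
      = complex_of_real (1 - 1 / (2 * (2 * real n ^ 2 - 4 * real n + 3))) * (-1)" if "1 \<le> n" for n
    using omega_at_return[OF that] by (simp only: curve_def radius_def if_True)
  then have "\<forall>\<^sub>F n in sequentially. complex_of_real (1 - 1 / (2 * (2 * real n ^ 2 - 4 * real n + 3))) * (-1)
      = curve (2 * real n ^ 2 - 4 * real n + 3)"
    by (intro eventually_sequentiallyI[of 1]) (rule sym)
  moreover have "(\<lambda>n. 1 - 1 / (2 * (2 * real n ^ 2 - 4 * real n + 3))) \<longlonglongrightarrow> 1" by real_asymp
  then have "(\<lambda>n. complex_of_real (1 - 1 / (2 * (2 * real n ^ 2 - 4 * real n + 3))) * (-1))
      \<longlonglongrightarrow> complex_of_real 1 * (-1)"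
    by (intro tendsto_intros)
  ultimately show ?thesis by (simp add: Lim_transform_eventually)
qed

lemma C0_apply_at_return_tendsto:
  "(\<lambda>n::nat. C0_apply f (curve (2 * real n ^ 2 - 4 * real n + 3))) \<longlonglongrightarrow> C0_apply f (-1)"
  by (rule continuous_on_tendsto_compose[OF C0_continuous_on curve_at_return_tendsto])
    (simp_all add: curve_in_phase_space curve_neq_1 phase_space_def)

lemma return_poly_nonneg: "0 \<le> poly [:3, -4, 2:] (int n)"
proof -
  have "0 \<le> 2 * (int n - 1) ^ 2 + 1" by simp
  also have "\<dots> = poly [:3, -4, 2:] (int n)" by (simp add: power2_eq_square algebra_simps)
  finally show ?thesis .
qed

lemma point_evaluation_T0_funpow:
  "point_evaluation (curve 0) ((T0 1 ^^ nat (poly [:3, -4, 2:] (int n))) f)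
    = C0_apply f (curve (2 * real n ^ 2 - 4 * real n + 3))"
proof -
  have "real (nat (poly [:3, -4, 2:] (int n))) = real_of_int (poly [:3, -4, 2:] (int n))"
    using return_poly_nonneg by (rule of_nat_nat)
  also have "\<dots> = 2 * real n ^ 2 - 4 * real n + 3" by (simp add: power2_eq_square algebra_simps)
  finally show ?thesis
    by (simp only: point_evaluation_def C0_apply_T0_funpow curve_in_phase_space if_True flow_curve add_0)
qed

lemma point_evaluation_T0_funpow_tendsto:
  "(\<lambda>n::nat. point_evaluation (curve 0) ((T0 1 ^^ nat (poly [:3, -4, 2:] (int n))) f))
    \<longlonglongrightarrow> C0_apply f (-1)"
  unfolding point_evaluation_T0_funpow by (rule C0_apply_at_return_tendsto)

text \<open>Evaluation at \<open>curve 0\<close> has the nonzero limit f(-1) along the full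
  sequence, hence along every subsequence. This excludes all index sequences of density 1 at once,
  and the identity covers plain weak convergence.\<close>

lemma not_weakly_null_along_returns:
  assumes f: "C0_apply f (-1) \<noteq> 0" and \<nu>: "strict_mono \<nu>"
  shows "\<not> weakly_tendsto (\<lambda>k::nat. (T0 1 ^^ nat (poly [:3, -4, 2:] (int (\<nu> k)))) f) 0"
proof
  assume "weakly_tendsto (\<lambda>k::nat. (T0 1 ^^ nat (poly [:3, -4, 2:] (int (\<nu> k)))) f) 0"
  then have "(\<lambda>k. point_evaluation (curve 0) ((T0 1 ^^ nat (poly [:3, -4, 2:] (int (\<nu> k)))) f))
      \<longlonglongrightarrow> point_evaluation (curve 0) 0"
    using bounded_clinear_point_evaluation unfolding weakly_tendsto_def by blast
  moreover have "(\<lambda>k. point_evaluation (curve 0) ((T0 1 ^^ nat (poly [:3, -4, 2:] (int (\<nu> k)))) f))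
      \<longlonglongrightarrow> C0_apply f (-1)"
    using LIMSEQ_subseq_LIMSEQ[OF point_evaluation_T0_funpow_tendsto \<nu>] by (simp only: comp_def)
  ultimately have "C0_apply f (-1) = point_evaluation (curve 0) 0" by (rule LIMSEQ_unique[rotated])
  then show False using f by (simp add: point_evaluation_def)
qed

lemma not_almost_weakly_polynomial_stable_T0: "\<not> almost_weakly_polynomial_stable (T0 1)"
proof
  assume stable: "almost_weakly_polynomial_stable (T0 1)"
  obtain f where f: "C0_apply f (-1) \<noteq> 0" using C0_nonzero_at_minus_1 by blast
  have "degree [:3, -4, 2 :: int:] > 0 \<and> (\<forall>n::nat. 1 \<le> n \<longrightarrow> 0 \<le> poly [:3, -4, 2:] (int n))"
    using return_poly_nonneg by (intro conjI allI impI) simp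
  then have "almost_weakly_stable_seq (\<lambda>n. (T0 1 ^^ nat (poly [:3, -4, 2:] (int n))) f)"
    using stable unfolding almost_weakly_polynomial_stable_def by blast
  then show False
    using not_weakly_null_along_returns[OF f] unfolding almost_weakly_stable_seq_def by blast
qed

theorem mainTheorem2:
  shows
    "continuous_flow_on phase_space flow
     \<and> (\<forall>f. \<forall>x\<in>phase_space. C0_apply (T0 1 f) x = C0_apply f (flow 1 x))
     \<and> bounded_clinear (T0 1) \<and> (\<forall>f. norm (T0 1 f) \<le> norm f)
     \<and> \<not> (\<exists>z. cmod z = 1 \<and> eigenvalue (T0 1) z)
     \<and> almost_weakly_stable (T0 1)
     \<and> (\<forall>n::nat. 1 \<le> n \<longrightarrow> omega (2 * real n ^ 2 - 4 * real n + 3) = - (2 * real n - 1) * pi)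
     \<and> (\<lambda>n::nat. curve (2 * real n ^ 2 - 4 * real n + 3)) \<longlonglongrightarrow> -1
     \<and> (\<forall>f. (\<lambda>n::nat. C0_apply f (curve (2 * real n ^ 2 - 4 * real n + 3)))
              \<longlonglongrightarrow> C0_apply f (-1))
     \<and> (\<forall>f. (\<lambda>n::nat. point_evaluation (curve 0)
                ((T0 1 ^^ nat (poly [:3, -4, 2:] (int n))) f)) \<longlonglongrightarrow> C0_apply f (-1))
     \<and> \<not> (\<forall>f. weakly_tendsto (\<lambda>n::nat. (T0 1 ^^ nat (poly [:3, -4, 2:] (int n))) f) 0)
     \<and> \<not> almost_weakly_polynomial_stable (T0 1)"
proof (intro conjI allI ballI impI)
  show "C0_apply (T0 1 f) x = C0_apply f (flow 1 x)" if "x \<in> phase_space" for f x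
    using that by (simp add: C0_apply_T0)
  show "\<not> (\<exists>z. cmod z = 1 \<and> eigenvalue (T0 1) z)"
    using no_unimodular_eigenvalue by blast
  show "\<not> (\<forall>f. weakly_tendsto (\<lambda>n::nat. (T0 1 ^^ nat (poly [:3, -4, 2:] (int n))) f) 0)"
    using C0_nonzero_at_minus_1 not_weakly_null_along_returns[OF _ strict_mono_id] by (auto simp: id_def)
qed (fact continuous_flow bounded_clinear_T0 norm_T0_le almost_weakly_stable_T0 omega_at_return
  curve_at_return_tendsto C0_apply_at_return_tendsto point_evaluation_T0_funpow_tendsto
  not_almost_weakly_polynomial_stable_T0 | assumption)+

end
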